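(* Let $p,k$ be positive integers and let \[\mathbf{k}=(\underbrace{k,\dots,k}_{p}),\qquad \tilde{\mathbf{k}}=(\underbrace{k+1,\dots,k+1}_{p-1},\,k-(p-1)).\] If $M$ is a matroid whose ground set has size $pk$, then \[\pi_{\mathbf{k}}(M)\ \ge\ \prod_{j=1}^{p-1}\left(1+\frac{j}{(p-1)k}\right)\pi_{\tilde{\mathbf{k}}}(M).\]
   Context: For a matroid $N$ with ground set $Y$ and an integer tuple $\mathbf{i}=(i_1,\dots,i_p)$, $\pi_{\mathbf{i}}(N)$ is the number of ordered set partitions $(A_1,\dots,A_p)$ of $Y$ (pairwise disjoint sets with union $Y$) such that each $A_s$ is independent in $N$ and $|A_s|=i_s$ (this number is $0$ if some $i_s<0$). *)

theory Defs
  imports Complex_Main "HOL-Library.Disjoint_Sets"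
begin

locale matroid =
  fixes Y :: "'a set" and indep :: "'a set \<Rightarrow> bool"
  assumes finite_ground: "finite Y"
    and indep_ground: "indep A \<Longrightarrow> A \<subseteq> Y"
    and indep_empty: "indep {}"
    and indep_subset: "indep B \<Longrightarrow> A \<subseteq> B \<Longrightarrow> indep A"
    and indep_exchange:
      "indep A \<Longrightarrow> indep B \<Longrightarrow> card A < card B \<Longrightarrow> \<exists>x\<in>B - A. indep (insert x A)"

(* The tuple of sizes is an int list; a negative entry makes the set empty because
   card is never negative. Disjointness is imposed on the indexed family, so the
   empty set may occur several times as a block. *)
definition indep_partitions ::
    "'a set \<Rightarrow> ('a set \<Rightarrow> bool) \<Rightarrow> int list \<Rightarrow> 'a set list set" where
  "indep_partitions Y indep is = {As. length As = length is
     \<and> disjoint_family_on (\<lambda>s. As ! s) {..<length is}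
     \<and> (\<Union>s<length is. As ! s) = Y
     \<and> (\<forall>s<length is. indep (As ! s) \<and> int (card (As ! s)) = is ! s)}"

definition num_indep_partitions ::
    "'a set \<Rightarrow> ('a set \<Rightarrow> bool) \<Rightarrow> int list \<Rightarrow> nat" where
  "num_indep_partitions Y indep is = card (indep_partitions Y indep is)"

lemma finite_indep_partitions:
  assumes "finite Y"
  shows "finite (indep_partitions Y indep is)"
proof (rule finite_subset)
  show "indep_partitions Y indep is \<subseteq> {As. set As \<subseteq> Pow Y \<and> length As = length is}"
    by (fastforce simp: indep_partitions_def in_set_conv_nth)
  show "finite {As. set As \<subseteq> Pow Y \<and> length As = length is}"
    using assms by (intro finite_lists_length_eq) simp
qed

end

theory Submission
  imports Defs "HOL-Analysis.Function_Topology" "HOL-Analysis.Convex" "HOL-Library.Multiset"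
begin

text \<open>
  Moving one element from a block of size k + 1 to the last block, of size b < k, multiplies the
  number of partitions by at least (k + 1) / (b + 1), hence by at least 1 + 1 / k; after p - 1 such
  moves this dominates the product. With the other blocks fixed, the claim is about the number f i of
  sets A with i elements such that A and its complement are both independent in a matroid on n
  elements, and it follows from the symmetry of f together with the log-concavity of
  i! (n - i)! f i.

  The log-concavity is a Lorentzian polynomial argument. The polynomial
  H = h(x, u) h(y, v), where h(x, u) is the sum of x^(n - |I|) u^I over independent I, has the numbers
  c! d! f d (c + d = n) as the coefficients that remain after applying the product of all
  operators d/du_j + d/dv_j and derivatives in x and y. The Hessians obtained by coordinate
  derivatives alone are hyperbolic by direct computation. Replacing one coordinate derivative by
  d/du_j + d/dv_j preserves hyperbolicity, by the Bochner method: for a symmetric trilinear form T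
  with hyperbolic slices, the operator B given by the sum of the slices and normalised by its row
  sums satisfies |B x|^2 >= (x, B x). So its eigenvalues are at most 0 or at least 1, while by
  connectedness of the support the eigenvalue 1 is simple and maximal.
\<close>

section \<open>Hyperbolic quadratic forms\<close>

definition qform :: "'e set \<Rightarrow> ('e \<Rightarrow> 'e \<Rightarrow> real) \<Rightarrow> ('e \<Rightarrow> real) \<Rightarrow> ('e \<Rightarrow> real) \<Rightarrow> real" where
  "qform E Q x y = (\<Sum>i\<in>E. \<Sum>j\<in>E. Q i j * x i * y j)"

text \<open>The reverse Cauchy-Schwarz inequality. For a finite \<open>E\<close> and a symmetric
  \<open>Q\<close> with nonnegative entries it says that \<open>Q\<close> has at most one positive
  eigenvalue.\<close>

definition hyperbolic :: "'e set \<Rightarrow> ('e \<Rightarrow> 'e \<Rightarrow> real) \<Rightarrow> bool" where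
  "hyperbolic E Q \<longleftrightarrow>
    (\<forall>x y. (\<forall>i\<in>E. 0 \<le> y i) \<longrightarrow> qform E Q x x * qform E Q y y \<le> (qform E Q x y)\<^sup>2)"

lemma qform_commute:
  assumes "\<And>i j. i \<in> E \<Longrightarrow> j \<in> E \<Longrightarrow> Q i j = Q j i"
  shows "qform E Q x y = qform E Q y x"
  unfolding qform_def
  by (subst sum.swap) (intro sum.cong refl, simp add: assms mult_ac)

lemma qform_add_left: "qform E Q (\<lambda>i. x i + y i) z = qform E Q x z + qform E Q y z"
  by (simp add: qform_def algebra_simps sum.distrib)

lemma qform_add_right: "qform E Q z (\<lambda>i. x i + y i) = qform E Q z x + qform E Q z y"
  by (simp add: qform_def algebra_simps sum.distrib)

lemma qform_scale_left: "qform E Q (\<lambda>i. c * x i) z = c * qform E Q x z"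
  by (simp add: qform_def sum_distrib_left mult_ac)

lemma qform_scale_right: "qform E Q z (\<lambda>i. c * x i) = c * qform E Q z x"
  by (simp add: qform_def sum_distrib_left mult_ac)

lemmas qform_linear = qform_add_left qform_add_right qform_scale_left qform_scale_right

lemma qform_cong:
  assumes "\<And>i j. i \<in> E \<Longrightarrow> j \<in> E \<Longrightarrow> Q i j = Q' i j"
    and "\<And>i. i \<in> E \<Longrightarrow> x i = x' i" and "\<And>i. i \<in> E \<Longrightarrow> y i = y' i"
  shows "qform E Q x y = qform E Q' x' y'"
  unfolding qform_def using assms by (intro sum.cong refl) simp

lemma qform_nonneg:
  assumes "\<And>i j. i \<in> E \<Longrightarrow> j \<in> E \<Longrightarrow> 0 \<le> Q i j"
    and "\<And>i. i \<in> E \<Longrightarrow> 0 \<le> x i" and "\<And>i. i \<in> E \<Longrightarrow> 0 \<le> y i"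
  shows "0 \<le> qform E Q x y"
  unfolding qform_def using assms by (intro sum_nonneg) simp

lemma qform_of_bool:
  assumes "finite E" "p \<in> E" "q \<in> E"
  shows "qform E Q (\<lambda>i. of_bool (i = p)) (\<lambda>i. of_bool (i = q)) = Q p q"
proof -
  have "(\<Sum>j\<in>E. Q i j * of_bool (i = p) * of_bool (j = q)) = (if i = p then Q i q else 0)" for i
  proof -
    have "(\<Sum>j\<in>E. Q i j * of_bool (i = p) * of_bool (j = q))
        = (\<Sum>j\<in>E. if j = q then Q i j * of_bool (i = p) else 0)"
      by (intro sum.cong refl) simp
    then show ?thesis using assms by simp
  qed
  then show ?thesis using assms by (simp add: qform_def)
qed

lemma hyperbolic_cong:
  assumes "\<And>i j. i \<in> E \<Longrightarrow> j \<in> E \<Longrightarrow> Q i j = Q' i j"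
  shows "hyperbolic E Q \<longleftrightarrow> hyperbolic E Q'"
proof -
  have "qform E Q x y = qform E Q' x y" for x y
    by (rule qform_cong) (simp_all add: assms)
  then show ?thesis by (simp add: hyperbolic_def)
qed

lemma hyperbolicD:
  assumes "hyperbolic E Q" and "\<And>i. i \<in> E \<Longrightarrow> 0 \<le> y i"
  shows "qform E Q x x * qform E Q y y \<le> (qform E Q x y)\<^sup>2"
  using assms by (auto simp: hyperbolic_def)

text \<open>A form that is nonpositive on a hyperplane has at most one positive direction: the
  combination \<open>z\<close> of \<open>x\<close> and \<open>y\<close> lies in the hyperplane, and
  completing the square in q(z, z) <= 0 gives the inequality.\<close>

lemma hyperbolicI:
  assumes sym: "\<And>i j. i \<in> E \<Longrightarrow> j \<in> E \<Longrightarrow> Q i j = Q j i"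
    and nonneg: "\<And>i j. i \<in> E \<Longrightarrow> j \<in> E \<Longrightarrow> 0 \<le> Q i j"
    and hyperplane: "\<And>z. (\<Sum>i\<in>E. l i * z i) = 0 \<Longrightarrow> qform E Q z z \<le> 0"
  shows "hyperbolic E Q"
  unfolding hyperbolic_def
proof (intro allI impI)
  fix x y :: "'a \<Rightarrow> real"
  assume y: "\<forall>i\<in>E. 0 \<le> y i"
  let ?q = "qform E Q"
  define p where "p = (\<Sum>i\<in>E. l i * x i)"
  define r where "r = (\<Sum>i\<in>E. l i * y i)"
  have yy: "0 \<le> ?q y y" using nonneg y by (intro qform_nonneg) auto
  define z where "z = (\<lambda>i. r * x i + (- p) * y i)"
  have "(\<Sum>i\<in>E. l i * z i) = r * (\<Sum>i\<in>E. l i * x i) + (- p) * (\<Sum>i\<in>E. l i * y i)"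
    by (simp only: z_def sum_distrib_left sum.distrib[symmetric] distrib_left mult.left_commute)
  also have "\<dots> = r * p + (- p) * r" by (simp only: p_def r_def)
  finally have "(\<Sum>i\<in>E. l i * z i) = r * p + (- p) * r" .
  then have "?q z z \<le> 0" by (intro hyperplane) simp
  also have "?q z z = r\<^sup>2 * ?q x x - 2 * p * r * ?q x y + p\<^sup>2 * ?q y y"
    unfolding z_def qform_linear using qform_commute[of E Q y x, OF sym]
    by (simp add: power2_eq_square algebra_simps)
  finally have z: "r\<^sup>2 * ?q x x - 2 * p * r * ?q x y + p\<^sup>2 * ?q y y \<le> 0" .
  show "?q x x * ?q y y \<le> (?q x y)\<^sup>2"
  proof (cases "?q y y = 0 \<or> r = 0")
    \<comment> \<open>If \<open>r = 0\<close>, then \<open>y\<close> itself lies in the hyperplane,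
      so q(y, y) is both nonpositive and nonnegative.\<close>
    case True
    then have "?q y y = 0"
      using hyperplane[of y] yy by (auto simp: r_def)
    then show ?thesis by simp
  next
    case False
    then have "?q y y > 0" "r\<^sup>2 > 0" using yy by auto
    have "(p * ?q y y - r * ?q x y)\<^sup>2 + r\<^sup>2 * (?q x x * ?q y y - (?q x y)\<^sup>2)
        = ?q y y * (r\<^sup>2 * ?q x x - 2 * p * r * ?q x y + p\<^sup>2 * ?q y y)"
      by (simp add: power2_eq_square algebra_simps)
    also have "\<dots> \<le> 0" using z yy by (simp add: mult_nonneg_nonpos)
    finally have "r\<^sup>2 * (?q x x * ?q y y - (?q x y)\<^sup>2) \<le> 0"
      using zero_le_power2[of "p * ?q y y - r * ?q x y"] by linarith
    then show ?thesis using \<open>r\<^sup>2 > 0\<close> by (simp add: mult_le_0_iff)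
  qed
qed

section \<open>Hyperbolicity from a spectral bound on the rows\<close>

text \<open>A closed subset of a product of compact intervals. Pinning the coordinates outside
  \<open>E\<close> to 0 lets Tychonoff's theorem apply in the full function space.\<close>

lemma weighted_sphere_compact:
  fixes D :: "'e \<Rightarrow> real"
  assumes "finite E" and D: "\<And>i. i \<in> E \<Longrightarrow> D i > 0"
  shows "compact {x. (\<forall>i. i \<notin> E \<longrightarrow> x i = 0) \<and> (\<Sum>i\<in>E. D i * (x i)\<^sup>2) = 1 \<and> (\<Sum>i\<in>E. D i * x i) = 0}"
    (is "compact ?S")
proof -
  \<comment> \<open>This radius avoids square roots: x_i^2 <= 1 / D_i <= (1 + 1 / D_i)^2.\<close>
  define c where "c i = 1 + 1 / D i" for i
  let ?B = "PiE UNIV (\<lambda>i. if i \<in> E then {- c i..c i} else {0})"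
  have "compact ?B"
    using compactin_PiE[of "\<lambda>_. euclidean" UNIV "\<lambda>i. if i \<in> E then {- c i..c i} else {0 :: real}"]
    by (subst (asm) euclidean_product_topology) simp
  have cont: "continuous_on UNIV (\<lambda>x :: 'e \<Rightarrow> real. x i)" for i
    by (rule continuous_on_product_coordinates)
  have "closed ((\<Inter>i\<in>-E. {x :: 'e \<Rightarrow> real. x i = 0}) \<inter> {x. (\<Sum>i\<in>E. D i * (x i)\<^sup>2) = 1} \<inter> {x. (\<Sum>i\<in>E. D i * x i) = 0})"
    by (intro closed_Int closed_INT ballI closed_Collect_eq continuous_intros cont)
  also have "(\<Inter>i\<in>-E. {x :: 'e \<Rightarrow> real. x i = 0}) \<inter> {x. (\<Sum>i\<in>E. D i * (x i)\<^sup>2) = 1} \<inter> {x. (\<Sum>i\<in>E. D i * x i) = 0} = ?S"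
    by auto
  finally have "closed ?S" .
  moreover have "?S \<subseteq> ?B"
  proof
    fix x assume x: "x \<in> ?S"
    have "\<bar>x i\<bar> \<le> c i" if i: "i \<in> E" for i
    proof -
      have "D i * (x i)\<^sup>2 \<le> (\<Sum>i\<in>E. D i * (x i)\<^sup>2)"
        using assms i by (intro member_le_sum) (auto simp: less_imp_le)
      then have "D i * (x i)\<^sup>2 \<le> 1" using x by simp
      then have "(x i)\<^sup>2 \<le> 1 / D i" using D[OF i] by (simp add: field_simps)
      also have "\<dots> \<le> (c i)\<^sup>2"
      proof -
        have "0 \<le> 1 / D i" and "0 \<le> 1 / D i * (1 / D i)" using D[OF i] by simp_all
        then show ?thesis unfolding c_def power2_eq_square distrib_left distrib_right by linarith
      qed
      finally show ?thesis
        using D[OF i] by (intro power2_le_imp_le[of "\<bar>x i\<bar>"]) (auto simp: c_def add_nonneg_nonneg)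
    qed
    then show "x \<in> ?B" using x by (auto simp: abs_le_iff) (metis minus_le_iff)
  qed
  ultimately show ?thesis using compact_Int_closed[OF \<open>compact ?B\<close>, of ?S] by (simp only: Int_absorb1)
qed

text \<open>First-order condition at an extremum: for nonzero \<open>u\<close>, a small step
  \<open>t = - s * u\<close> lets the linear term dominate and makes the expression
  negative.\<close>

lemma nonneg_quadratic_linear_coeff:
  fixes u v :: real
  assumes "\<And>t. 0 \<le> 2 * t * u + t\<^sup>2 * v"
  shows "u = 0"
proof (rule ccontr)
  assume "u \<noteq> 0"
  define s where "s = 1 / (\<bar>v\<bar> + 1)"
  have s: "s > 0" "s * v \<le> 1" by (auto simp: s_def field_simps)
  have "2 * (- s * u) * u + (- s * u)\<^sup>2 * v = s * u\<^sup>2 * (s * v - 2)"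
    by (simp add: power2_eq_square algebra_simps)
  also have "\<dots> < 0" using s \<open>u \<noteq> 0\<close> by (intro mult_pos_neg) auto
  finally show False using assms[of "- s * u"] by simp
qed

text \<open>The left side is the Dirichlet energy of the graph with edge weights \<open>Q\<close>.
  For nonnegative weights it bounds the form by the norm weighted with the row sums, and it vanishes
  only if \<open>x\<close> is constant along edges.\<close>

lemma qform_weight_identity:
  assumes sym: "\<And>i j. i \<in> E \<Longrightarrow> j \<in> E \<Longrightarrow> Q i j = Q j i"
  shows "(\<Sum>i\<in>E. \<Sum>j\<in>E. Q i j * (x i - x j)\<^sup>2) =
    2 * (\<Sum>i\<in>E. (\<Sum>j\<in>E. Q i j) * (x i)\<^sup>2) - 2 * qform E Q x x"
proof -
  have "(\<Sum>i\<in>E. \<Sum>j\<in>E. Q i j * (x j)\<^sup>2) = (\<Sum>i\<in>E. \<Sum>j\<in>E. Q i j * (x i)\<^sup>2)"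
    by (subst sum.swap) (intro sum.cong refl, simp add: sym)
  then show ?thesis
    by (simp add: qform_def power2_diff algebra_simps sum.distrib sum_subtractf
        sum_distrib_left sum_distrib_right power2_eq_square)
qed

text \<open>Let B be \<open>Q\<close> with each row divided by its sum D_i; it is self-adjoint for
  the inner product weighted by D. If q were positive at some vector of weighted mean 0, its
  maximiser on the unit sphere of such vectors would be an eigenvector with eigenvalue m > 0. The
  row bound gives m <= m^2, so m >= 1 and the Dirichlet energy vanishes. Connectedness then makes
  the maximiser constant, hence 0 by its mean, a contradiction.\<close>

lemma hyperbolic_of_row_bound:
  assumes fin: "finite E"
    and sym: "\<And>i j. i \<in> E \<Longrightarrow> j \<in> E \<Longrightarrow> Q i j = Q j i"
    and nonneg: "\<And>i j. i \<in> E \<Longrightarrow> j \<in> E \<Longrightarrow> 0 \<le> Q i j"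
    \<comment> \<open>rows with sum 0 vanish, and contribute 0 on the right because x / 0 = 0\<close>
    and bound: "\<And>x. qform E Q x x \<le> (\<Sum>i\<in>E. (\<Sum>j\<in>E. Q i j * x j)\<^sup>2 / (\<Sum>j\<in>E. Q i j))"
    and conn: "\<And>r :: 'e \<Rightarrow> real. (\<And>i j. i \<in> E \<Longrightarrow> j \<in> E \<Longrightarrow> Q i j > 0 \<Longrightarrow> r i = r j) \<Longrightarrow>
      \<exists>c. \<forall>i\<in>E. \<forall>j\<in>E. Q i j > 0 \<longrightarrow> r i = c"
  shows "hyperbolic E Q"
proof (rule hyperbolicI[OF sym nonneg])
  define D where "D i = (\<Sum>j\<in>E. Q i j)" for i
  fix z :: "'e \<Rightarrow> real"
  assume "(\<Sum>i\<in>E. (\<Sum>j\<in>E. Q i j) * z i) = 0"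
  then have z0: "(\<Sum>i\<in>E. D i * z i) = 0" by (simp add: D_def)
  let ?q = "qform E Q"
  have D0: "D i \<ge> 0" if "i \<in> E" for i using nonneg that by (auto simp: D_def intro: sum_nonneg)
  \<comment> \<open>The weighted norm is definite only on the rows with positive sum, so the sphere
    is taken there; the other rows vanish and do not change q.\<close>
  define F where "F = {i\<in>E. D i > 0}"
  have F: "finite F" "F \<subseteq> E" "\<And>i. i \<in> F \<Longrightarrow> D i > 0" using fin by (auto simp: F_def)
  have row0: "Q i j = 0" if "i \<in> E - F" "j \<in> E" for i j
  proof -
    have "(\<Sum>j\<in>E. Q i j) = 0" using that D0[of i] by (auto simp: F_def D_def)
    then show ?thesis using that fin nonneg by (subst (asm) sum_nonneg_eq_0_iff) auto
  qed
  have sumF: "(\<Sum>i\<in>E. D i * g i) = (\<Sum>i\<in>F. D i * g i)" for g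
  proof (rule sum.mono_neutral_right)
    show "\<forall>i\<in>E - F. D i * g i = 0" using D0 by (auto simp: F_def order_class.less_le)
  qed (use F fin in auto)
  have q1: "?q x (\<lambda>_. 1) = (\<Sum>i\<in>E. D i * x i)" for x
    by (simp add: qform_def D_def sum_distrib_right)
  have upper: "?q x x \<le> (\<Sum>i\<in>E. D i * (x i)\<^sup>2)" for x
  proof -
    have "0 \<le> (\<Sum>i\<in>E. \<Sum>j\<in>E. Q i j * (x i - x j)\<^sup>2)"
      using nonneg by (intro sum_nonneg) auto
    then show ?thesis using qform_weight_identity[of E Q x, OF sym] by (simp add: D_def)
  qed
  define S where "S = {x. (\<forall>i. i \<notin> F \<longrightarrow> x i = 0) \<and> (\<Sum>i\<in>F. D i * (x i)\<^sup>2) = 1 \<and> (\<Sum>i\<in>F. D i * x i) = 0}"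
  have "compact S" unfolding S_def by (rule weighted_sphere_compact) (use F in auto)
  have qF: "?q (\<lambda>i. if i \<in> F then x i else 0) (\<lambda>i. if i \<in> F then x i else 0) = ?q x x" for x
    unfolding qform_def
  proof (intro sum.cong refl)
    fix i j assume ij: "i \<in> E" "j \<in> E"
    show "Q i j * (if i \<in> F then x i else 0) * (if j \<in> F then x j else 0) = Q i j * x i * x j"
      using row0[of i j] row0[of j i] sym[OF ij] ij by auto
  qed
  define n where "n x = (\<lambda>i. if i \<in> F then x i / sqrt (\<Sum>i\<in>F. D i * (x i)\<^sup>2) else 0)" for x :: "'e \<Rightarrow> real"
  have nq: "?q (n x) (n x) = ?q x x / (\<Sum>i\<in>F. D i * (x i)\<^sup>2)"
    and nS: "(\<Sum>i\<in>E. D i * x i) = 0 \<Longrightarrow> n x \<in> S"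
    if pos: "(\<Sum>i\<in>F. D i * (x i)\<^sup>2) > 0" for x
  proof -
    let ?N = "\<Sum>i\<in>F. D i * (x i)\<^sup>2"
    let ?y = "\<lambda>i. if i \<in> F then x i else 0"
    have "n x = (\<lambda>i. (1 / sqrt ?N) * ?y i)" by (auto simp: n_def)
    then have "?q (n x) (n x) = (1 / sqrt ?N) * ((1 / sqrt ?N) * ?q ?y ?y)"
      by (simp only: qform_linear)
    then show "?q (n x) (n x) = ?q x x / ?N" using pos by (simp only: qF) (simp add: field_simps)
    assume x0: "(\<Sum>i\<in>E. D i * x i) = 0"
    have "(\<Sum>i\<in>F. D i * (n x i)\<^sup>2) = (\<Sum>i\<in>F. D i * (x i)\<^sup>2 / ?N)"
      using pos by (intro sum.cong refl) (auto simp: n_def power_divide)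
    moreover have "(\<Sum>i\<in>F. D i * n x i) = (\<Sum>i\<in>F. D i * x i / sqrt ?N)"
      by (intro sum.cong refl) (auto simp: n_def)
    ultimately show "n x \<in> S"
      using pos x0 sumF[of x] by (auto simp: S_def n_def simp flip: sum_divide_distrib)
  qed
  show "?q z z \<le> 0"
  proof (rule ccontr)
    assume "\<not> ?q z z \<le> 0"
    then have zpos: "?q z z > 0" by simp
    then have "(\<Sum>i\<in>F. D i * (z i)\<^sup>2) > 0" using upper[of z] by (simp add: sumF)
    note nz = nq[OF this] nS[OF this z0]
    have "continuous_on S (\<lambda>x. ?q x x)"
      unfolding qform_def
      by (intro continuous_intros continuous_on_subset[OF continuous_on_product_coordinates]) auto
    then obtain x where xS: "x \<in> S" and xmax: "\<And>y. y \<in> S \<Longrightarrow> ?q y y \<le> ?q x x"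
      using continuous_attains_sup[OF \<open>compact S\<close>] nz(2) by blast
    define m where "m = ?q x x"
    have "m > 0"
      using xmax[OF nz(2)] zpos upper[of z] by (auto simp: nz(1) m_def sumF intro: less_le_trans[rotated] divide_pos_pos)
    have x1: "(\<Sum>i\<in>E. D i * (x i)\<^sup>2) = 1" and x0: "(\<Sum>i\<in>E. D i * x i) = 0"
      using xS by (auto simp: S_def sumF)
    \<comment> \<open>Homogeneity carries maximality from the sphere to all vectors of weighted mean
      0.\<close>
    have top: "?q y y \<le> m * (\<Sum>i\<in>E. D i * (y i)\<^sup>2)" if y0: "(\<Sum>i\<in>E. D i * y i) = 0" for y
    proof (cases "(\<Sum>i\<in>F. D i * (y i)\<^sup>2) > 0")
      case True
      from xmax[OF nS[OF True y0]] have "?q y y / (\<Sum>i\<in>F. D i * (y i)\<^sup>2) \<le> m"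
        by (simp add: nq[OF True] m_def)
      then show ?thesis using True by (simp add: sumF field_simps)
    next
      case False
      moreover have "0 \<le> (\<Sum>i\<in>F. D i * (y i)\<^sup>2)" using F by (intro sum_nonneg) (auto simp: less_imp_le)
      ultimately show ?thesis using upper[of y] by (simp add: sumF)
    qed
    have orth: "?q x y = m * (\<Sum>i\<in>E. D i * x i * y i)" if y0: "(\<Sum>i\<in>E. D i * y i) = 0" for y
    proof -
      let ?u = "m * (\<Sum>i\<in>E. D i * x i * y i) - ?q x y"
      let ?v = "m * (\<Sum>i\<in>E. D i * (y i)\<^sup>2) - ?q y y"
      \<comment> \<open>First variation: \<open>x + t * y\<close> keeps weighted mean 0, and the
        defect in \<open>top\<close> is 0 at \<open>t = 0\<close>.\<close>
      have "0 \<le> 2 * t * ?u + t\<^sup>2 * ?v" for t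
      proof -
        have "(\<Sum>i\<in>E. D i * (x i + t * y i)) = 0"
          using x0 y0 by (simp add: algebra_simps sum.distrib flip: sum_distrib_left)
        from top[OF this] have "0 \<le> m * (\<Sum>i\<in>E. D i * (x i + t * y i)\<^sup>2)
            - ?q (\<lambda>i. x i + t * y i) (\<lambda>i. x i + t * y i)" by simp
        also have "(\<Sum>i\<in>E. D i * (x i + t * y i)\<^sup>2) =
            1 + 2 * t * (\<Sum>i\<in>E. D i * x i * y i) + t\<^sup>2 * (\<Sum>i\<in>E. D i * (y i)\<^sup>2)"
          by (simp add: x1[symmetric] power2_eq_square algebra_simps sum.distrib sum_distrib_left)
        also have "?q (\<lambda>i. x i + t * y i) (\<lambda>i. x i + t * y i) = m + 2 * t * ?q x y + t\<^sup>2 * ?q y y"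
          unfolding qform_linear using qform_commute[of E Q y x, OF sym]
          by (simp add: m_def power2_eq_square algebra_simps)
        finally show ?thesis by (simp add: algebra_simps)
      qed
      then have "?u = 0" by (rule nonneg_quadratic_linear_coeff)
      then show ?thesis by simp
    qed
    define W where "W = (\<Sum>i\<in>E. D i)"
    have "W > 0"
    proof -
      have "F \<noteq> {}" using x1 by (auto simp: sumF)
      then have "0 < (\<Sum>i\<in>F. D i)" using F by (intro sum_pos) auto
      then show ?thesis using sumF[of "\<lambda>_. 1"] by (simp add: W_def)
    qed
    \<comment> \<open>the maximiser x is an eigenvector with eigenvalue m, which the row bound forces to be at least 1\<close>
    have eig: "(\<Sum>j\<in>E. Q k j * x j) = m * D k * x k" if k: "k \<in> E" for k
    proof -
      define s where "s = D k / W"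
      \<comment> \<open>The indicator of \<open>k\<close>, shifted by a constant to weighted mean 0.
        The shift does not affect the pairings with \<open>x\<close>, which has weighted mean 0
        itself.\<close>
      define y where "y = (\<lambda>i. (if i = k then 1 else 0) + (- s) * (1::real))"
      have "(\<Sum>i\<in>E. D i * y i) = (\<Sum>i\<in>E. (if i = k then D i else 0) - s * D i)"
        by (intro sum.cong refl) (simp add: y_def algebra_simps)
      also have "\<dots> = D k - s * W"
        using k fin by (simp add: W_def sum_subtractf sum_distrib_left)
      finally have y0: "(\<Sum>i\<in>E. D i * y i) = 0" using \<open>W > 0\<close> by (simp add: s_def)
      have "?q x y = ?q x (\<lambda>i. if i = k then 1 else 0)"
        unfolding y_def qform_linear using q1[of x] x0 by simp
      also have "\<dots> = (\<Sum>i\<in>E. Q i k * x i)"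
        using k fin by (simp add: qform_def if_distrib cong: if_cong)
      also have "\<dots> = (\<Sum>j\<in>E. Q k j * x j)" using sym k by (intro sum.cong) auto
      finally have 1: "?q x y = (\<Sum>j\<in>E. Q k j * x j)" .
      have "(\<Sum>i\<in>E. D i * x i * y i) = (\<Sum>i\<in>E. (if i = k then D i * x i else 0) - s * (D i * x i))"
        by (intro sum.cong refl) (simp add: y_def algebra_simps)
      also have "\<dots> = D k * x k - s * (\<Sum>i\<in>E. D i * x i)"
        using k fin by (simp add: sum_subtractf sum_distrib_left)
      finally have "(\<Sum>i\<in>E. D i * x i * y i) = D k * x k - s * (\<Sum>i\<in>E. D i * x i)" .
      then show ?thesis using orth[OF y0] 1 x0 by simp
    qed
    have "m \<le> (\<Sum>i\<in>E. (\<Sum>j\<in>E. Q i j * x j)\<^sup>2 / D i)"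
      using bound[of x] by (simp only: m_def D_def)
    also have "\<dots> = (\<Sum>i\<in>E. (m * D i * x i)\<^sup>2 / D i)"
      by (intro sum.cong refl) (simp add: eig)
    also have "\<dots> = (\<Sum>i\<in>E. m\<^sup>2 * (D i * (x i)\<^sup>2))"
      by (intro sum.cong refl) (auto simp: power2_eq_square)
    also have "\<dots> = m\<^sup>2" using x1 by (simp flip: sum_distrib_left)
    finally have "m \<ge> 1" using \<open>m > 0\<close> by (simp add: power2_eq_square)
    \<comment> \<open>The energy equals 2 - 2m.\<close>
    have "(\<Sum>i\<in>E. \<Sum>j\<in>E. Q i j * (x i - x j)\<^sup>2) \<le> 0"
      using qform_weight_identity[of E Q x, OF sym] x1 \<open>m \<ge> 1\<close> by (simp add: D_def m_def)
    moreover have nn: "0 \<le> Q i j * (x i - x j)\<^sup>2" if "i \<in> E" "j \<in> E" for i j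
      using nonneg that by simp
    ultimately have "(\<Sum>i\<in>E. \<Sum>j\<in>E. Q i j * (x i - x j)\<^sup>2) = 0"
      by (intro antisym sum_nonneg) auto
    then have "\<forall>i\<in>E. (\<Sum>j\<in>E. Q i j * (x i - x j)\<^sup>2) = 0"
      using fin nn by (subst (asm) sum_nonneg_eq_0_iff) (auto intro: sum_nonneg)
    then have "\<forall>i\<in>E. \<forall>j\<in>E. Q i j * (x i - x j)\<^sup>2 = 0"
      using fin nn by (auto simp: sum_nonneg_eq_0_iff)
    then have "x i = x j" if "i \<in> E" "j \<in> E" "Q i j > 0" for i j using that by force
    then obtain c where c: "\<And>i j. i \<in> E \<Longrightarrow> j \<in> E \<Longrightarrow> Q i j > 0 \<Longrightarrow> x i = c"
      using conn[of x] by auto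
    have xc: "x i = c" if "i \<in> F" for i
    proof -
      have "i \<in> E" using that F by auto
      have "\<exists>j\<in>E. Q i j > 0"
      proof (rule ccontr)
        assume "\<not> ?thesis"
        then have "D i \<le> 0" by (auto simp: D_def not_less intro: sum_nonpos)
        then show False using F(3)[OF that] by simp
      qed
      then show ?thesis using c \<open>i \<in> E\<close> by blast
    qed
    have "c * W = (\<Sum>i\<in>F. D i * x i)"
      using sumF[of "\<lambda>_. 1"] by (simp add: W_def xc sum_distrib_left mult.commute)
    also have "\<dots> = 0" using x0 unfolding sumF .
    finally have "c = 0" using \<open>W > 0\<close> by simp
    then have "(\<Sum>i\<in>F. D i * (x i)\<^sup>2) = 0" using xc by (intro sum.neutral) auto
    then show False using x1 unfolding sumF by simp
  qed
qed

section \<open>Contracting a trilinear form with hyperbolic slices\<close>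

lemma hyperbolic_scale:
  assumes "hyperbolic E Q" and c: "c \<ge> 0" and a: "\<And>i. i \<in> E \<Longrightarrow> 0 \<le> a i"
  shows "hyperbolic E (\<lambda>i j. c * Q i j * a i * a j)"
  unfolding hyperbolic_def
proof (intro allI impI)
  fix x y :: "'a \<Rightarrow> real" assume y: "\<forall>i\<in>E. 0 \<le> y i"
  let ?Q = "\<lambda>i j. c * Q i j * a i * a j"
  have eq: "qform E ?Q x y = c * qform E Q (\<lambda>i. a i * x i) (\<lambda>i. a i * y i)" for x y
    by (simp add: qform_def sum_distrib_left mult_ac)
  have "qform E Q (\<lambda>i. a i * x i) (\<lambda>i. a i * x i) * qform E Q (\<lambda>i. a i * y i) (\<lambda>i. a i * y i)
      \<le> (qform E Q (\<lambda>i. a i * x i) (\<lambda>i. a i * y i))\<^sup>2"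
    using y a by (intro hyperbolicD assms(1)) auto
  from mult_left_mono[OF this, of "c * c"]
  show "qform E ?Q x x * qform E ?Q y y \<le> (qform E ?Q x y)\<^sup>2"
    unfolding eq by (simp add: power2_eq_square mult_ac)
qed

text \<open>By symmetry of \<open>T\<close>, row i of the sum Q satisfies D_i = T_i(1, 1) and (Q
  x)_i = T_i(x, 1), while q(x, x) is the sum of the T_i(x, x). Hyperbolicity of each slice against
  the all-ones vector, summed over i, is therefore exactly the row bound.\<close>

lemma hyperbolic_sum_slices:
  assumes fin: "finite E"
    and sym1: "\<And>i j k. i \<in> E \<Longrightarrow> j \<in> E \<Longrightarrow> k \<in> E \<Longrightarrow> T i j k = T j i k"
    and sym2: "\<And>i j k. i \<in> E \<Longrightarrow> j \<in> E \<Longrightarrow> k \<in> E \<Longrightarrow> T i j k = T i k j"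
    and nonneg: "\<And>i j k. i \<in> E \<Longrightarrow> j \<in> E \<Longrightarrow> k \<in> E \<Longrightarrow> 0 \<le> T i j k"
    and slices: "\<And>i. i \<in> E \<Longrightarrow> hyperbolic E (T i)"
    and conn: "\<And>r :: 'e \<Rightarrow> real.
      (\<And>i j k. i \<in> E \<Longrightarrow> j \<in> E \<Longrightarrow> k \<in> E \<Longrightarrow> T i j k > 0 \<Longrightarrow> r i = r j) \<Longrightarrow>
      \<exists>c. \<forall>i\<in>E. \<forall>j\<in>E. \<forall>k\<in>E. T i j k > 0 \<longrightarrow> r i = c"
  shows "hyperbolic E (\<lambda>j k. \<Sum>i\<in>E. T i j k)"
proof -
  define Q where "Q j k = (\<Sum>i\<in>E. T i j k)" for j k
  have Q': "Q j k = (\<Sum>i\<in>E. T j k i)" if "j \<in> E" "k \<in> E" for j k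
    unfolding Q_def using that by (intro sum.cong refl) (metis sym1 sym2)
  have rowsum: "(\<Sum>k\<in>E. Q i k * x k) = qform E (T i) x (\<lambda>_. 1)" if "i \<in> E" for i x
    unfolding qform_def using that by (intro sum.cong refl) (simp add: Q' sum_distrib_right)
  have "hyperbolic E Q"
  proof (rule hyperbolic_of_row_bound[OF fin])
    show "Q i j = Q j i" if "i \<in> E" "j \<in> E" for i j
      unfolding Q_def using that by (intro sum.cong refl sym2) auto
    show "0 \<le> Q i j" if "i \<in> E" "j \<in> E" for i j
      unfolding Q_def using that by (intro sum_nonneg nonneg) auto
    fix x :: "'e \<Rightarrow> real"
    have "qform E Q x x = (\<Sum>i\<in>E. \<Sum>j\<in>E. \<Sum>k\<in>E. T i j k * x j * x k)"
      unfolding qform_def Q_def sum_distrib_right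
      by (subst (2) sum.swap, subst sum.swap) (rule refl)
    also have "\<dots> = (\<Sum>i\<in>E. qform E (T i) x x)" by (simp add: qform_def)
    also have "\<dots> \<le> (\<Sum>i\<in>E. (\<Sum>j\<in>E. Q i j * x j)\<^sup>2 / (\<Sum>j\<in>E. Q i j))"
    proof (rule sum_mono)
      fix i assume i: "i \<in> E"
      let ?D = "\<Sum>j\<in>E. Q i j"
      have D: "?D = qform E (T i) (\<lambda>_. 1) (\<lambda>_. 1)" using rowsum[OF i, of "\<lambda>_. 1"] by simp
      have "?D \<ge> 0" unfolding D using nonneg i by (intro qform_nonneg) auto
      show "qform E (T i) x x \<le> (\<Sum>j\<in>E. Q i j * x j)\<^sup>2 / ?D"
      proof (cases "?D = 0")
        case True
        have "T i j k = 0" if "j \<in> E" "k \<in> E" for j k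
        proof -
          have "Q i j = 0"
            using True i that fin nonneg by (subst (asm) sum_nonneg_eq_0_iff) (auto simp: Q_def intro: sum_nonneg)
          then show ?thesis using i that fin nonneg
            by (simp add: Q') (subst (asm) sum_nonneg_eq_0_iff, auto)
        qed
        then have "qform E (T i) x x = 0" by (simp add: qform_def)
        then show ?thesis using True by simp
      next
        case False
        then have "?D > 0" using \<open>?D \<ge> 0\<close> by simp
        have "qform E (T i) x x * ?D \<le> (\<Sum>j\<in>E. Q i j * x j)\<^sup>2"
          unfolding D rowsum[OF i] by (rule hyperbolicD[OF slices[OF i]]) simp
        then show ?thesis using \<open>?D > 0\<close> by (simp add: field_simps)
      qed
    qed
    finally show "qform E Q x x \<le> (\<Sum>i\<in>E. (\<Sum>j\<in>E. Q i j * x j)\<^sup>2 / (\<Sum>j\<in>E. Q i j))" .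
  next
    fix r :: "'e \<Rightarrow> real"
    assume r: "\<And>i j. i \<in> E \<Longrightarrow> j \<in> E \<Longrightarrow> Q i j > 0 \<Longrightarrow> r i = r j"
    have pos: "Q i j > 0 \<longleftrightarrow> (\<exists>k\<in>E. T i j k > 0)" if "i \<in> E" "j \<in> E" for i j
    proof
      assume "Q i j > 0"
      then show "\<exists>k\<in>E. T i j k > 0"
        using that by (simp add: Q') (meson not_less sum_nonpos)
    next
      assume "\<exists>k\<in>E. T i j k > 0"
      then obtain k where "k \<in> E" "T i j k > 0" by blast
      then show "Q i j > 0" unfolding Q'[OF that] using that fin nonneg by (intro sum_pos2[of E k]) auto
    qed
    have "\<exists>c. \<forall>i\<in>E. \<forall>j\<in>E. \<forall>k\<in>E. T i j k > 0 \<longrightarrow> r i = c"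
      by (rule conn) (use r pos in blast)
    then show "\<exists>c. \<forall>i\<in>E. \<forall>j\<in>E. Q i j > 0 \<longrightarrow> r i = c" using pos by meson
  qed
  then show ?thesis by (simp add: Q_def[abs_def])
qed

text \<open>Rescaling all three indices by \<open>a\<close> turns the direction \<open>a\<close>
  into the all-ones direction without changing the support; the two remaining indices are scaled
  back at the end.\<close>

lemma hyperbolic_direction_pos:
  assumes fin: "finite E"
    and sym1: "\<And>i j k. i \<in> E \<Longrightarrow> j \<in> E \<Longrightarrow> k \<in> E \<Longrightarrow> T i j k = T j i k"
    and sym2: "\<And>i j k. i \<in> E \<Longrightarrow> j \<in> E \<Longrightarrow> k \<in> E \<Longrightarrow> T i j k = T i k j"
    and nonneg: "\<And>i j k. i \<in> E \<Longrightarrow> j \<in> E \<Longrightarrow> k \<in> E \<Longrightarrow> 0 \<le> T i j k"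
    and slices: "\<And>i. i \<in> E \<Longrightarrow> hyperbolic E (T i)"
    and conn: "\<And>r :: 'e \<Rightarrow> real.
      (\<And>i j k. i \<in> E \<Longrightarrow> j \<in> E \<Longrightarrow> k \<in> E \<Longrightarrow> T i j k > 0 \<Longrightarrow> r i = r j) \<Longrightarrow>
      \<exists>c. \<forall>i\<in>E. \<forall>j\<in>E. \<forall>k\<in>E. T i j k > 0 \<longrightarrow> r i = c"
    and a: "\<And>i. i \<in> E \<Longrightarrow> 0 < a i"
  shows "hyperbolic E (\<lambda>j k. \<Sum>i\<in>E. a i * T i j k)"
proof -
  define T' where "T' i j k = a i * T i j k * a j * a k" for i j k
  have pos: "T' i j k > 0 \<longleftrightarrow> T i j k > 0" if "i \<in> E" "j \<in> E" "k \<in> E" for i j k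
    using a[OF that(1)] a[OF that(2)] a[OF that(3)] by (simp add: T'_def zero_less_mult_iff)
  have "hyperbolic E (\<lambda>j k. \<Sum>i\<in>E. T' i j k)"
  proof (rule hyperbolic_sum_slices[OF fin])
    show "T' i j k = T' j i k" if "i \<in> E" "j \<in> E" "k \<in> E" for i j k
      using sym1[OF that] by (simp add: T'_def mult_ac)
    show "T' i j k = T' i k j" if "i \<in> E" "j \<in> E" "k \<in> E" for i j k
      using sym2[OF that] by (simp add: T'_def mult_ac)
    show "0 \<le> T' i j k" if "i \<in> E" "j \<in> E" "k \<in> E" for i j k
      using nonneg[OF that] a that by (simp add: T'_def less_imp_le)
    show "hyperbolic E (T' i)" if "i \<in> E" for i
    proof -
      have "T' i = (\<lambda>j k. a i * T i j k * a j * a k)" by (simp add: T'_def fun_eq_iff)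
      then show ?thesis
        using hyperbolic_scale[OF slices[OF that], of "a i" a] a that by (simp add: less_imp_le)
    qed
    fix r :: "'e \<Rightarrow> real"
    assume "\<And>i j k. i \<in> E \<Longrightarrow> j \<in> E \<Longrightarrow> k \<in> E \<Longrightarrow> T' i j k > 0 \<Longrightarrow> r i = r j"
    then have "\<exists>c. \<forall>i\<in>E. \<forall>j\<in>E. \<forall>k\<in>E. T i j k > 0 \<longrightarrow> r i = c"
      by (intro conn) (simp add: pos)
    then show "\<exists>c. \<forall>i\<in>E. \<forall>j\<in>E. \<forall>k\<in>E. T' i j k > 0 \<longrightarrow> r i = c"
      by (simp add: pos)
  qed
  from hyperbolic_scale[OF this, of 1 "\<lambda>i. 1 / a i"]
  have "hyperbolic E (\<lambda>j k. (\<Sum>i\<in>E. T' i j k) * (1 / a j) * (1 / a k))"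
    using a by (simp add: less_imp_le)
  also have "?this \<longleftrightarrow> ?thesis"
  proof (rule hyperbolic_cong)
    fix j k assume "j \<in> E" "k \<in> E"
    then show "(\<Sum>i\<in>E. T' i j k) * (1 / a j) * (1 / a k) = (\<Sum>i\<in>E. a i * T i j k)"
      using a[of j] a[of k] by (simp add: T'_def sum_divide_distrib)
  qed
  finally show ?thesis .
qed

text \<open>The inequality is closed, so it passes to the limit e -> 0 of the positive directions
  \<open>a + e\<close>. This covers directions with zero entries, such as that of d/du_j +
  d/dv_j.\<close>

lemma hyperbolic_direction:
  assumes fin: "finite E"
    and sym1: "\<And>i j k. i \<in> E \<Longrightarrow> j \<in> E \<Longrightarrow> k \<in> E \<Longrightarrow> T i j k = T j i k"
    and sym2: "\<And>i j k. i \<in> E \<Longrightarrow> j \<in> E \<Longrightarrow> k \<in> E \<Longrightarrow> T i j k = T i k j"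
    and nonneg: "\<And>i j k. i \<in> E \<Longrightarrow> j \<in> E \<Longrightarrow> k \<in> E \<Longrightarrow> 0 \<le> T i j k"
    and slices: "\<And>i. i \<in> E \<Longrightarrow> hyperbolic E (T i)"
    and conn: "\<And>r :: 'e \<Rightarrow> real.
      (\<And>i j k. i \<in> E \<Longrightarrow> j \<in> E \<Longrightarrow> k \<in> E \<Longrightarrow> T i j k > 0 \<Longrightarrow> r i = r j) \<Longrightarrow>
      \<exists>c. \<forall>i\<in>E. \<forall>j\<in>E. \<forall>k\<in>E. T i j k > 0 \<longrightarrow> r i = c"
    and a: "\<And>i. i \<in> E \<Longrightarrow> 0 \<le> a i"
  shows "hyperbolic E (\<lambda>j k. \<Sum>i\<in>E. a i * T i j k)"
  unfolding hyperbolic_def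
proof (intro allI impI)
  fix x y :: "'e \<Rightarrow> real" assume y: "\<forall>i\<in>E. 0 \<le> y i"
  define q where "q e = qform E (\<lambda>j k. \<Sum>i\<in>E. (a i + e) * T i j k)" for e :: real
  have lim: "((\<lambda>e. q e u v) \<longlongrightarrow> q 0 u v) (at_right 0)" for u v
    unfolding q_def qform_def by (intro tendsto_intros)
  have "q 0 x x * q 0 y y \<le> (q 0 x y)\<^sup>2"
  proof (rule tendsto_le)
    show "((\<lambda>e. q e x x * q e y y) \<longlongrightarrow> q 0 x x * q 0 y y) (at_right 0)"
      by (intro tendsto_intros lim)
    show "((\<lambda>e. (q e x y)\<^sup>2) \<longlongrightarrow> (q 0 x y)\<^sup>2) (at_right 0)"
      by (intro tendsto_intros lim)
    have "q e x x * q e y y \<le> (q e x y)\<^sup>2" if "e > 0" for e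
      unfolding q_def
    proof (rule hyperbolicD)
      show "hyperbolic E (\<lambda>j k. \<Sum>i\<in>E. (a i + e) * T i j k)"
      proof (rule hyperbolic_direction_pos[OF fin sym1 sym2 nonneg slices conn])
        show "0 < a i + e" if "i \<in> E" for i using a[OF that] \<open>e > 0\<close> by simp
      qed
    qed (use y in auto)
    then show "eventually (\<lambda>e. q e x x * q e y y \<le> (q e x y)\<^sup>2) (at_right 0)"
      by (simp add: eventually_at_filter)
  qed simp
  then show "qform E (\<lambda>j k. \<Sum>i\<in>E. a i * T i j k) x x * qform E (\<lambda>j k. \<Sum>i\<in>E. a i * T i j k) y y
      \<le> (qform E (\<lambda>j k. \<Sum>i\<in>E. a i * T i j k) x y)\<^sup>2"
    by (simp add: q_def)
qed

section \<open>Weights of pairs of independent sets\<close>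

text \<open>The double sum is the sum over the classes of \<open>R\<close> of the squared class
  sums, so this is Cauchy-Schwarz over at most \<open>card L\<close> classes. The quotient is
  avoided by giving each element i the share \<open>C i / n i\<close> of its class sum.\<close>

lemma sum_squared_le_equiv_sum:
  fixes z :: "'a \<Rightarrow> real"
  assumes fin: "finite L"
    and refl: "\<And>i. i \<in> L \<Longrightarrow> R i i"
    and sym: "\<And>i j. i \<in> L \<Longrightarrow> j \<in> L \<Longrightarrow> R i j \<Longrightarrow> R j i"
    and trans: "\<And>i j k. i \<in> L \<Longrightarrow> j \<in> L \<Longrightarrow> k \<in> L \<Longrightarrow> R i j \<Longrightarrow> R j k \<Longrightarrow> R i k"
  shows "(\<Sum>i\<in>L. z i)\<^sup>2 \<le> card L * (\<Sum>i\<in>L. \<Sum>j\<in>L. of_bool (R i j) * z i * z j)"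
proof -
  \<comment> \<open>\<open>n i\<close> is the size of the class of i, and \<open>C i\<close> is the
    sum of \<open>z\<close> over that class.\<close>
  define n where "n i = (\<Sum>j\<in>L. of_bool (R i j) :: real)" for i
  define C where "C i = (\<Sum>j\<in>L. of_bool (R i j) * z j)" for i
  have inv: "R i k \<longleftrightarrow> R j k" if "i \<in> L" "j \<in> L" "k \<in> L" "R i j" for i j k
    using that sym trans by blast
  have n_inv: "n i = n j" and C_inv: "C i = C j" if "i \<in> L" "j \<in> L" "R i j" for i j
    unfolding n_def C_def using that by (auto intro!: sum.cong simp: inv[of i j])
  have n1: "n i \<ge> 1" if "i \<in> L" for i
    using member_le_sum[of i L "\<lambda>j. of_bool (R i j) :: real"] that fin refl by (simp add: n_def)
  have swap: "(\<Sum>i\<in>L. C i * g i) = (\<Sum>j\<in>L. z j * g j * n j)"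
    if g: "\<And>i j. i \<in> L \<Longrightarrow> j \<in> L \<Longrightarrow> R i j \<Longrightarrow> g i = g j" for g
  proof -
    have "(\<Sum>i\<in>L. C i * g i) = (\<Sum>j\<in>L. \<Sum>i\<in>L. of_bool (R i j) * z j * g i)"
      unfolding C_def sum_distrib_right by (rule sum.swap)
    also have "\<dots> = (\<Sum>j\<in>L. \<Sum>i\<in>L. of_bool (R j i) * z j * g j)"
    proof (intro sum.cong HOL.refl)
      fix i j assume "i \<in> L" "j \<in> L"
      then show "of_bool (R i j) * z j * g i = of_bool (R j i) * z j * g j"
        using sym[of i j] sym[of j i] g[of i j] by auto
    qed
    also have "\<dots> = (\<Sum>j\<in>L. z j * g j * n j)"
      by (simp add: n_def sum_distrib_left mult_ac)
    finally show ?thesis .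
  qed
  have "(\<Sum>i\<in>L. C i * (1 / n i)) = (\<Sum>j\<in>L. z j * (1 / n j) * n j)"
    by (rule swap) (simp add: n_inv)
  also have "\<dots> = (\<Sum>j\<in>L. z j)" using n1 by (intro sum.cong HOL.refl) force
  finally have "(\<Sum>i\<in>L. z i)\<^sup>2 = (\<Sum>i\<in>L. C i / n i)\<^sup>2" by simp
  also have "\<dots> \<le> (\<Sum>i\<in>L. (C i / n i)\<^sup>2) * card L"
    by (rule sum_squared_le_sum_of_squares)
  also have "(\<Sum>i\<in>L. (C i / n i)\<^sup>2) \<le> (\<Sum>i\<in>L. C i * (C i / n i))"
  proof (rule sum_mono)
    fix i assume "i \<in> L"
    then have "(C i)\<^sup>2 * (1 / n i)\<^sup>2 \<le> (C i)\<^sup>2 * (1 / n i)"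
      using n1[of i] by (intro mult_left_mono) (auto simp: power2_eq_square divide_simps)
    then show "(C i / n i)\<^sup>2 \<le> C i * (C i / n i)"
      by (simp add: power2_eq_square)
  qed
  also have "(\<Sum>i\<in>L. C i * (C i / n i)) = (\<Sum>j\<in>L. z j * (C j / n j) * n j)"
    by (rule swap) (metis C_inv n_inv)
  also have "\<dots> = (\<Sum>i\<in>L. \<Sum>j\<in>L. of_bool (R i j) * z i * z j)"
  proof (rule sum.cong[OF HOL.refl])
    fix i assume "i \<in> L"
    then have "z i * (C i / n i) * n i = z i * C i" using n1[of i] by simp
    then show "z i * (C i / n i) * n i = (\<Sum>j\<in>L. of_bool (R i j) * z i * z j)"
      by (simp add: C_def sum_distrib_left mult_ac)
  qed
  finally show ?thesis by (simp add: mult.commute mult_right_mono)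
qed

text \<open>
  A monomial in x and the u_j is a multiset over \<open>'a option\<close>, where \<open>None\<close> stands for x; the flag
  \<open>False\<close> marks the variables x, u_j and \<open>True\<close> the variables y, v_j. A polynomial is represented by
  its constant iterated derivatives, which is why \<open>wt\<close> below contains a factorial.
\<close>

definition support :: "'a option multiset \<Rightarrow> 'a set" where
  "support \<mu> = {j. Some j \<in># \<mu>}"

lemma support_simps [simp]:
  "support (add_mset None \<mu>) = support \<mu>"
  "support (add_mset (Some j) \<mu>) = insert j (support \<mu>)"
  "support (\<mu> + \<nu>) = support \<mu> \<union> support \<nu>"
  "support {#} = {}"
  by (auto simp: support_def)

lemma support_image_Some [simp]: "finite A \<Longrightarrow> support (image_mset Some (mset_set A)) = A"
  by (auto simp: support_def)

lemma finite_support [simp]: "finite (support \<mu>)"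
  by (induction \<mu>) (auto, metis option.exhaust support_simps(1,2) finite_insert)

definition part :: "bool \<Rightarrow> (bool \<times> 'a option) multiset \<Rightarrow> 'a option multiset" where
  "part b m = image_mset snd (filter_mset (\<lambda>e. fst e = b) m)"

lemma part_simps [simp]:
  "part b {#} = {#}"
  "part b (add_mset e m) = (if fst e = b then add_mset (snd e) (part b m) else part b m)"
  "part b (m + m') = part b m + part b m'"
  by (auto simp: part_def)

lemma part_replicate [simp]:
  "part b (replicate_mset c (b', u)) = (if b = b' then replicate_mset c u else {#})"
  by (induction c) auto

definition embed :: "bool \<Rightarrow> 'a set \<Rightarrow> (bool \<times> 'a option) multiset" where
  "embed b A = image_mset (\<lambda>j. (b, Some j)) (mset_set A)"

lemma part_embed [simp]:
  "part b (embed b' A) = (if b = b' then image_mset Some (mset_set A) else {#})"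
  unfolding embed_def part_def by (simp add: filter_mset_image_mset image_mset.compositionality comp_def)

lemma size_parts: "size m = size (part False m) + size (part True m)"
  by (induction m) auto

lemma sum_bool_Times:
  "(\<Sum>e\<in>UNIV \<times> B. g e) = (\<Sum>u\<in>B. g (b, u)) + (\<Sum>u\<in>B. g (\<not> b, u))"
proof -
  have "(\<Sum>e\<in>UNIV \<times> B. g e) = (\<Sum>b\<in>UNIV. \<Sum>u\<in>B. g (b, u))"
    by (simp add: sum.cartesian_product)
  then show ?thesis by (cases b) (simp_all add: UNIV_bool add.commute)
qed

context matroid
begin

text \<open>The monomials that can occur in h: squarefree in the u_j with independent support. The
  exponent of x is then fixed by the total degree \<open>card Y\<close>.\<close>

definition good :: "'a option multiset \<Rightarrow> bool" where
  "good \<mu> \<longleftrightarrow> (\<forall>j. count \<mu> (Some j) \<le> 1) \<and> indep (support \<mu>)"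

definition wt :: "'a option multiset \<Rightarrow> real" where
  "wt \<mu> = (if good \<mu> \<and> size \<mu> = card Y then fact (count \<mu> None) else 0)"

definition wt2 :: "(bool \<times> 'a option) multiset \<Rightarrow> real" where
  "wt2 m = wt (part False m) * wt (part True m)"

text \<open>The derivative of H along m and along all operators d/du_j + d/dv_j with j in K.\<close>

definition split_wt :: "'a set \<Rightarrow> (bool \<times> 'a option) multiset \<Rightarrow> real" where
  "split_wt K m = (\<Sum>A\<in>Pow K. wt2 (m + embed False A + embed True (K - A)))"

abbreviation coords :: "'a option set" where
  "coords \<equiv> insert None (Some ` Y)"

lemma finite_indep: "indep A \<Longrightarrow> finite A"
  using finite_ground indep_ground finite_subset by blast

lemma good_add_None [simp]: "good (add_mset None \<mu>) = good \<mu>"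
  by (simp add: good_def)

lemma good_add_Some [simp]:
  "good (add_mset (Some j) \<mu>) \<longleftrightarrow> j \<notin> support \<mu> \<and> indep (insert j (support \<mu>)) \<and> good \<mu>"
proof -
  have "count \<mu> (Some j) \<le> 0 \<longleftrightarrow> j \<notin> support \<mu>"
    by (auto simp: support_def not_in_iff)
  moreover have "(\<forall>i. count (add_mset (Some j) \<mu>) (Some i) \<le> 1) \<longleftrightarrow>
      count \<mu> (Some j) \<le> 0 \<and> (\<forall>i. count \<mu> (Some i) \<le> 1)"
    by (auto simp: le_Suc_eq)
  ultimately show ?thesis
    unfolding good_def using indep_subset[of "insert j (support \<mu>)" "support \<mu>"] by auto
qed

lemma good_add: "good (add_mset u \<mu>) \<Longrightarrow> good \<mu>"
  by (cases u) auto

lemma good_add_set: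
  assumes "finite A"
  shows "good (\<mu> + image_mset Some (mset_set A)) \<longleftrightarrow>
    good \<mu> \<and> support \<mu> \<inter> A = {} \<and> indep (support \<mu> \<union> A)"
  using assms
proof (induction A)
  case empty
  then show ?case by (auto simp: good_def)
next
  case (insert x A)
  then show ?case
    using indep_subset[of "support \<mu> \<union> insert x A" "support \<mu> \<union> A"] by auto
qed

lemma good_replicate [simp]: "good (replicate_mset c None)"
  by (induction c) (auto simp: good_def indep_empty)

lemma size_good: "good \<mu> \<Longrightarrow> size \<mu> = count \<mu> None + card (support \<mu>)"
proof (induction \<mu>)
  case (add u \<mu>)
  then show ?case by (cases u) auto
qed auto

lemma wt_nonneg [simp]: "0 \<le> wt \<mu>"
  by (simp add: wt_def)

lemma wt_pos_iff: "0 < wt \<mu> \<longleftrightarrow> good \<mu> \<and> size \<mu> = card Y"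
  by (simp add: wt_def)

lemma wt2_nonneg [simp]: "0 \<le> wt2 m"
  by (simp add: wt2_def)

lemma wt2_pos_iff: "0 < wt2 m \<longleftrightarrow> (\<forall>b. good (part b m) \<and> size (part b m) = card Y)"
proof -
  have "0 < wt2 m \<longleftrightarrow> 0 < wt (part False m) \<and> 0 < wt (part True m)"
    using wt_nonneg[of "part False m"] by (auto simp: wt2_def zero_less_mult_iff simp del: wt_nonneg)
  then show ?thesis by (auto simp: wt_pos_iff all_bool_eq)
qed

lemma split_wt_nonneg [simp]: "0 \<le> split_wt K m"
  by (simp add: split_wt_def sum_nonneg)

lemma split_wt_pos_iff:
  assumes "finite K"
  shows "0 < split_wt K m \<longleftrightarrow> (\<exists>A\<subseteq>K. 0 < wt2 (m + embed False A + embed True (K - A)))"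
proof -
  have "split_wt K m \<noteq> 0 \<longleftrightarrow> (\<exists>A\<subseteq>K. wt2 (m + embed False A + embed True (K - A)) \<noteq> 0)"
    unfolding split_wt_def using assms by (subst sum_nonneg_eq_0_iff) auto
  then show ?thesis using split_wt_nonneg[of K m] wt2_nonneg by (metis less_le)
qed

section \<open>Hessians after coordinate derivatives\<close>

text \<open>In the contraction by the support S of \<open>\<mu>\<close>, the Hessian is, up to a
  factorial, (c+2)(c+1) X^2 + 2(c+1) X s + s^2 - P, where s sums z over the non-loops and P sums the
  squared parallel-class sums. Since there are at most c+2 non-loops, s^2 <= (c+2) P, and this makes
  the form nonpositive where (c+2) X + s = 0.\<close>

lemma wt_pair_hyperplane:
  assumes size: "size \<mu> + 2 = card Y"
  shows "\<exists>l. \<forall>z. (\<Sum>u\<in>coords. l u * z u) = 0 \<longrightarrow>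
    qform coords (\<lambda>u v. wt (add_mset u (add_mset v \<mu>))) z z \<le> 0"
proof (cases "good \<mu>")
  case False
  then have "wt (add_mset u (add_mset v \<mu>)) = 0" for u v
    by (auto simp: wt_def dest: good_add)
  then show ?thesis by (simp add: qform_def)
next
  case True
  define S where "S = support \<mu>"
  define c where "c = count \<mu> None"
  \<comment> \<open>\<open>L\<close> is the set of non-loops and \<open>par\<close> is parallelism
    in the contraction by \<open>S\<close>.\<close>
  define L where "L = {j \<in> Y. j \<notin> S \<and> indep (insert j S)}"
  define par where "par i j \<longleftrightarrow> i = j \<or> \<not> indep (insert i (insert j S))" for i j
  have "finite S" "S \<subseteq> Y" using True indep_ground by (auto simp: S_def good_def)
  have L: "finite L" "L \<subseteq> Y" using finite_ground by (auto simp: L_def)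
  have "c + card S + 2 = card Y" using size size_good[OF True] by (simp add: S_def c_def)
  moreover have "card L \<le> card (Y - S)" using finite_ground by (intro card_mono) (auto simp: L_def)
  ultimately have cardL: "card L \<le> c + 2"
    using \<open>finite S\<close> \<open>S \<subseteq> Y\<close> by (simp add: card_Diff_subset)
  let ?w = "\<lambda>u v. wt (add_mset u (add_mset v \<mu>))"
  have w1: "?w None None = fact c * ((real c + 2) * (real c + 1))"
    using True size by (simp add: wt_def c_def algebra_simps)
  have w2: "?w None (Some j) = fact c * (real c + 1) * of_bool (j \<in> L)"
       "?w (Some j) None = fact c * (real c + 1) * of_bool (j \<in> L)" if "j \<in> Y" for j
    using True size that by (auto simp: wt_def c_def L_def S_def algebra_simps)
  have w3: "?w (Some i) (Some j) = fact c * (of_bool (i \<in> L) * of_bool (j \<in> L) * (1 - of_bool (par i j)))"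
    if "i \<in> Y" "j \<in> Y" for i j
  proof -
    have "indep (insert i S)" "indep (insert j S)" if "indep (insert i (insert j S))"
      using indep_subset[OF that] by blast+
    then show ?thesis using True size that
      by (auto simp: wt_def c_def L_def S_def par_def)
  qed
  have sumc: "(\<Sum>u\<in>coords. g u) = g None + (\<Sum>j\<in>Y. g (Some j))" for g :: "_ \<Rightarrow> real"
    using finite_ground by (simp add: sum.reindex)
  have restrict: "(\<Sum>j\<in>Y. of_bool (j \<in> L) * g j) = (\<Sum>j\<in>L. g j)" for g :: "_ \<Rightarrow> real"
    using finite_ground L by (simp add: of_bool_def if_distrib[of "\<lambda>x. x * _"] sum.If_cases Int_absorb1 cong: if_cong)
  \<comment> \<open>Proportional to the row of the Hessian at \<open>None\<close>.\<close>
  define l :: "'a option \<Rightarrow> real" where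
    "l u = (case u of None \<Rightarrow> real c + 2 | Some j \<Rightarrow> of_bool (j \<in> L))" for u
  have "qform coords ?w z z \<le> 0" if l0: "(\<Sum>u\<in>coords. l u * z u) = 0" for z
  proof -
    define X where "X = z None"
    define s where "s = (\<Sum>j\<in>L. z (Some j))"
    define P where "P = (\<Sum>i\<in>L. \<Sum>j\<in>L. of_bool (par i j) * z (Some i) * z (Some j))"
    have lin: "(real c + 2) * X + s = 0"
      using l0 by (simp add: sumc l_def X_def s_def restrict)
    have "s\<^sup>2 \<le> card L * P"
      unfolding s_def P_def
    proof (rule sum_squared_le_equiv_sum)
      \<comment> \<open>Transitivity of parallelism is the exchange axiom: an independent pair i, k
        over \<open>S\<close> would extend \<open>insert j S\<close> by i or by k.\<close>
      show "par i k" if ijk: "i \<in> L" "j \<in> L" "k \<in> L" and par: "par i j" "par j k" for i j k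
      proof (rule ccontr)
        assume "\<not> par i k"
        then have ik: "i \<noteq> k" "indep (insert i (insert k S))" by (auto simp: par_def)
        have "indep (insert j S)" using ijk by (simp add: L_def)
        moreover have "card (insert j S) < card (insert i (insert k S))"
          using ijk ik \<open>finite S\<close> by (auto simp: L_def)
        ultimately obtain x where "x \<in> insert i (insert k S) - insert j S" "indep (insert x (insert j S))"
          using indep_exchange[OF _ ik(2)] by blast
        then show False using par by (auto simp: par_def insert_commute)
      qed
    qed (use L in \<open>auto simp: par_def insert_commute\<close>)
    have "P \<ge> 0"
    proof (cases "card L = 0")
      case True
      then show ?thesis using L by (simp add: P_def)
    next
      case False
      then show ?thesis using order_trans[OF zero_le_power2 \<open>s\<^sup>2 \<le> card L * P\<close>]
        by (simp add: zero_le_mult_iff)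
    qed
    then have "card L * P \<le> (real c + 2) * P" using cardL by (intro mult_right_mono) auto
    with \<open>s\<^sup>2 \<le> card L * P\<close> have sP: "s\<^sup>2 \<le> (real c + 2) * P" by linarith
    have "(\<Sum>j\<in>Y. ?w None (Some j) * z None * z (Some j)) = fact c * (real c + 1) * X * s"
         "(\<Sum>j\<in>Y. ?w (Some j) None * z (Some j) * z None) = fact c * (real c + 1) * X * s"
      by (simp_all add: w2 X_def s_def sum_distrib_left mult_ac flip: restrict)
    moreover have "(\<Sum>i\<in>Y. \<Sum>j\<in>Y. ?w (Some i) (Some j) * z (Some i) * z (Some j)) = fact c * (s\<^sup>2 - P)"
    proof -
      have "(\<Sum>i\<in>Y. \<Sum>j\<in>Y. ?w (Some i) (Some j) * z (Some i) * z (Some j))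
        = (\<Sum>i\<in>Y. of_bool (i \<in> L) * (\<Sum>j\<in>Y. of_bool (j \<in> L) *
            (fact c * (z (Some i) * z (Some j) - of_bool (par i j) * z (Some i) * z (Some j)))))"
        unfolding sum_distrib_left by (intro sum.cong refl) (simp add: w3 algebra_simps)
      also have "\<dots> = (\<Sum>i\<in>L. \<Sum>j\<in>L. fact c * (z (Some i) * z (Some j) - of_bool (par i j) * z (Some i) * z (Some j)))"
        by (simp only: restrict)
      also have "\<dots> = fact c * (s\<^sup>2 - P)"
        by (simp add: s_def P_def power2_eq_square sum_product sum_subtractf flip: sum_distrib_left)
      finally show ?thesis .
    qed
    ultimately have q: "qform coords ?w z z = fact c *
        ((real c + 2) * (real c + 1) * X\<^sup>2 + 2 * (real c + 1) * X * s + s\<^sup>2 - P)"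
      unfolding qform_def sumc sum.distrib w1
      by (simp add: X_def algebra_simps power2_eq_square)
    have "(real c + 2) * ((real c + 2) * (real c + 1) * X\<^sup>2 + 2 * (real c + 1) * X * s + s\<^sup>2 - P)
        = (real c + 1) * ((real c + 2) * X + s)\<^sup>2 + (s\<^sup>2 - (real c + 2) * P)"
      by (simp add: power2_eq_square algebra_simps)
    also have "\<dots> \<le> 0" using lin sP by simp
    finally have "(real c + 2) * (real c + 1) * X\<^sup>2 + 2 * (real c + 1) * X * s + s\<^sup>2 - P \<le> 0"
      by (simp add: mult_le_0_iff)
    then show ?thesis unfolding q by (simp add: mult_le_0_iff)
  qed
  then show ?thesis by blast
qed

lemma wt2_eq: "wt2 m = wt (part b m) * wt (part (\<not> b) m)"
  by (cases b) (simp_all add: wt2_def)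

text \<open>H has degree \<open>card Y\<close> in each flag, so the two missing derivatives belong
  either to one flag or one to each. The Hessian is then a multiple of a Hessian of h, or 2 p q for
  linear forms p and q; in all other cases it is 0.\<close>

lemma hyperbolic_wt2:
  assumes size: "size m + 2 = 2 * card Y"
  shows "hyperbolic (UNIV \<times> coords) (\<lambda>i j. wt2 (add_mset i (add_mset j m)))"
proof -
  let ?E = "UNIV \<times> coords :: (bool \<times> 'a option) set"
  let ?Q = "\<lambda>i j. wt2 (add_mset i (add_mset j m))"
  have fin: "finite coords" using finite_ground by simp
  have "\<exists>l. \<forall>z. (\<Sum>e\<in>?E. l e * z e) = 0 \<longrightarrow> qform ?E ?Q z z \<le> 0"
  proof -
    consider (two) b where "size (part b m) + 2 = card Y" "size (part (\<not> b) m) = card Y"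
      | (one) "size (part False m) + 1 = card Y" "size (part True m) + 1 = card Y"
      | (none) "\<And>i j. ?Q i j = 0"
    proof -
      let ?a = "size (part False m)" and ?b = "size (part True m)"
      have ab: "?a + ?b + 2 = 2 * card Y" using size size_parts[of m] by simp
      have "?Q i j = 0"
        if "?a + 2 \<noteq> card Y" "?b + 2 \<noteq> card Y" "?a + 1 \<noteq> card Y" for i j
        using that ab by (cases "fst i"; cases "fst j") (auto simp: wt2_def wt_def)
      then show thesis
        using ab two[of False] two[of True] one none by (cases "?a + 2 = card Y"; cases "?b + 2 = card Y"; cases "?a + 1 = card Y") auto
    qed
    then show ?thesis
    proof cases
      case two
      obtain l where l: "\<And>z. (\<Sum>u\<in>coords. l u * z u) = 0 \<Longrightarrow>
          qform coords (\<lambda>u v. wt (add_mset u (add_mset v (part b m)))) z z \<le> 0"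
        using wt_pair_hyperplane[OF two(1)] by blast
      define l' where "l' e = (if fst e = b then l (snd e) else 0)" for e
      have Q: "?Q (b, u) (b, v) = wt (part (\<not> b) m) * wt (add_mset u (add_mset v (part b m)))"
          "?Q (b, u) (\<not> b, v) = 0" "?Q (\<not> b, u) (b, v) = 0" "?Q (\<not> b, u) (\<not> b, v) = 0" for u v
        using two by (auto simp: wt2_eq[of _ b] wt_def)
      have "qform ?E ?Q z z \<le> 0" if "(\<Sum>e\<in>?E. l' e * z e) = 0" for z
      proof -
        have "(\<Sum>u\<in>coords. l u * z (b, u)) = 0"
          using that by (simp add: sum_bool_Times[of _ _ b] l'_def)
        note neg = l[OF this]
        have "qform ?E ?Q z z = wt (part (\<not> b) m) *
          qform coords (\<lambda>u v. wt (add_mset u (add_mset v (part b m)))) (\<lambda>u. z (b, u)) (\<lambda>u. z (b, u))"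
          unfolding qform_def sum_bool_Times[of _ _ b] Q by (simp add: sum_distrib_left mult_ac)
        then show ?thesis using neg by (simp add: mult_nonneg_nonpos)
      qed
      then show ?thesis by blast
    next
      case one
      define l :: "bool \<times> 'a option \<Rightarrow> real" where
        \<comment> \<open>The hyperplane is p = 0, where the form 2 p q vanishes.\<close>
        "l e = (if fst e then 0 else wt (add_mset (snd e) (part False m)))" for e
      have Q: "?Q (False, u) (True, v) = wt (add_mset u (part False m)) * wt (add_mset v (part True m))"
        "?Q (True, u) (False, v) = wt (add_mset u (part True m)) * wt (add_mset v (part False m))"
        "?Q (False, u) (False, v) = 0" "?Q (True, u) (True, v) = 0" for u v
        using one by (auto simp: wt2_def wt_def)
      have "qform ?E ?Q z z \<le> 0" if "(\<Sum>e\<in>?E. l e * z e) = 0" for z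
      proof -
        define p where "p = (\<Sum>u\<in>coords. wt (add_mset u (part False m)) * z (False, u))"
        define q where "q = (\<Sum>u\<in>coords. wt (add_mset u (part True m)) * z (True, u))"
        have "p = 0"
          using that by (simp add: sum_bool_Times[of _ _ False] l_def p_def)
        have 1: "(\<Sum>u\<in>coords. \<Sum>v\<in>coords. ?Q (False, u) (True, v) * z (False, u) * z (True, v)) = p * q"
          unfolding p_def q_def sum_product Q by (intro sum.cong refl) (simp only: mult_ac)
        have 2: "(\<Sum>u\<in>coords. \<Sum>v\<in>coords. ?Q (True, u) (False, v) * z (True, u) * z (False, v)) = q * p"
          unfolding p_def q_def sum_product Q by (intro sum.cong refl) (simp only: mult_ac)
        have "qform ?E ?Q z z = p * q + q * p"
          unfolding qform_def sum_bool_Times[of _ _ False] sum.distrib not_False_eq_True 1 2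
          by (simp only: Q(3,4) mult_zero_left sum.neutral_const add_0_left add_0_right)
        then show ?thesis using \<open>p = 0\<close> by simp
      qed
      then show ?thesis by blast
    next
      case none
      then show ?thesis by (simp add: qform_def)
    qed
  qed
  then obtain l where "\<And>z. (\<Sum>e\<in>?E. l e * z e) = 0 \<Longrightarrow> qform ?E ?Q z z \<le> 0" by blast
  then show ?thesis
    by (intro hyperbolicI[where l = l]) (simp_all add: add_mset_commute)
qed

section \<open>Hessians after the operators d/du_j + d/dv_j\<close>

text \<open>Expanding the operator of \<open>j\<close>: the sets A containing \<open>j\<close>
  contribute d/du_j, the others d/dv_j.\<close>

lemma split_wt_insert:
  assumes "finite K" "j \<notin> K"
  shows "split_wt (insert j K) m =
    split_wt K (add_mset (False, Some j) m) + split_wt K (add_mset (True, Some j) m)"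
proof -
  let ?g = "\<lambda>K m A. wt2 (m + embed False A + embed True (K - A))"
  have "split_wt (insert j K) m = (\<Sum>A\<in>Pow K. ?g (insert j K) m A) + (\<Sum>A\<in>insert j ` Pow K. ?g (insert j K) m A)"
    unfolding split_wt_def Pow_insert using assms by (intro sum.union_disjoint) auto
  also have "(\<Sum>A\<in>Pow K. ?g (insert j K) m A) = split_wt K (add_mset (True, Some j) m)"
    unfolding split_wt_def
  proof (intro sum.cong refl)
    fix A assume A: "A \<in> Pow K"
    then have "insert j K - A = insert j (K - A)" using assms by auto
    then show "?g (insert j K) m A = ?g K (add_mset (True, Some j) m) A"
      using assms by (simp add: embed_def)
  qed
  also have "(\<Sum>A\<in>insert j ` Pow K. ?g (insert j K) m A) = split_wt K (add_mset (False, Some j) m)"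
    unfolding split_wt_def
  proof (subst sum.reindex)
    show "inj_on (insert j) (Pow K)" using assms by (auto simp: inj_on_def)
    show "sum (?g (insert j K) m \<circ> insert j) (Pow K) = (\<Sum>A\<in>Pow K. ?g K (add_mset (False, Some j) m) A)"
    proof (intro sum.cong refl)
      fix A assume A: "A \<in> Pow K"
      then have "insert j K - insert j A = K - A" "j \<notin> A" "finite A"
        using assms finite_subset by auto
      then show "(?g (insert j K) m \<circ> insert j) A = ?g K (add_mset (False, Some j) m) A"
        using assms by (simp add: embed_def)
    qed
  qed
  finally show ?thesis by simp
qed

text \<open>
  Connectedness of the support: every active coordinate is adjacent to x or to y, and the exchange
  axiom makes x and y adjacent when both are active.
\<close>

lemma split_wt_hub:
  assumes K: "finite K" and pos: "0 < split_wt K (add_mset (b, u) m)"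
  shows "0 < split_wt K (add_mset (b, None) m)"
proof -
  obtain A where A: "A \<subseteq> K" "0 < wt2 (add_mset (b, u) m + embed False A + embed True (K - A))"
    using pos by (auto simp: split_wt_pos_iff[OF K])
  have "0 < wt2 (add_mset (b, None) m + embed False A + embed True (K - A))"
    unfolding wt2_pos_iff
  proof
    fix b'
    from A(2) have "good (part b' (add_mset (b, u) m + embed False A + embed True (K - A))) \<and>
        size (part b' (add_mset (b, u) m + embed False A + embed True (K - A))) = card Y"
      unfolding wt2_pos_iff by blast
    then show "good (part b' (add_mset (b, None) m + embed False A + embed True (K - A))) \<and>
        size (part b' (add_mset (b, None) m + embed False A + embed True (K - A))) = card Y"
      by (auto dest: good_add)
  qed
  then show ?thesis using A(1) by (auto simp: split_wt_pos_iff[OF K])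
qed

lemma split_wt_exchange:
  assumes K: "finite K"
    and F: "0 < split_wt K (add_mset (False, None) (add_mset (False, None) (add_mset (False, None) m)))"
    and T: "0 < split_wt K (add_mset (True, None) (add_mset (True, None) (add_mset (True, None) m)))"
  shows "0 < split_wt K (add_mset (False, None) (add_mset (True, None) (add_mset (False, None) m)))"
proof -
  note fin = finite_subset[OF _ K]
  let ?F = "part False m" and ?T = "part True m"
  obtain A where A: "A \<subseteq> K" and "0 < wt2 (add_mset (False, None) (add_mset (False, None) (add_mset (False, None) m))
      + embed False A + embed True (K - A))"
    using F by (auto simp: split_wt_pos_iff[OF K])
  then have A1: "good ?F" "support ?F \<inter> A = {}" "indep (support ?F \<union> A)"
      "good ?T" "support ?T \<inter> (K - A) = {}" "indep (support ?T \<union> (K - A))"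
      "size ?F + card A + 3 = card Y" "size ?T + card (K - A) = card Y"
    using fin[OF A] K by (auto simp: wt2_pos_iff all_bool_eq good_add_set)
  obtain B where B: "B \<subseteq> K" and "0 < wt2 (add_mset (True, None) (add_mset (True, None) (add_mset (True, None) m))
      + embed False B + embed True (K - B))"
    using T by (auto simp: split_wt_pos_iff[OF K])
  then have B1: "support ?F \<inter> B = {}" "indep (support ?F \<union> B)" "size ?F + card B = card Y"
    using fin[OF B] K by (auto simp: wt2_pos_iff all_bool_eq good_add_set)
  \<comment> \<open>\<open>B\<close> has three elements more than \<open>A\<close>, replacing the
    three x-derivatives. Moving one element x of B - A from the v side to the u side yields the
    required triple with two x and one y.\<close>
  have "card (support ?F \<union> A) < card (support ?F \<union> B)"
    using A1 B1 fin[OF A] fin[OF B] by (simp add: card_Un_disjoint)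
  then obtain x where x: "x \<in> (support ?F \<union> B) - (support ?F \<union> A)" "indep (insert x (support ?F \<union> A))"
    using indep_exchange A1(3) B1(2) by blast
  then have xK: "x \<in> K" "x \<notin> A" "x \<notin> support ?F" using B by auto
  have "card (K - A) = Suc (card (K - insert x A))"
    using xK K by (metis Diff_iff Diff_insert card.remove finite_Diff)
  moreover have "indep (support ?T \<union> (K - insert x A))"
    by (rule indep_subset[OF A1(6)]) auto
  moreover have "finite A" using fin[OF A] .
  moreover have "support ?F \<inter> insert x A = {}" "support ?T \<inter> (K - insert x A) = {}" "indep (support ?F \<union> insert x A)"
    using A1 xK x(2) by auto
  ultimately have "0 < wt2 (add_mset (False, None) (add_mset (True, None) (add_mset (False, None) m))
      + embed False (insert x A) + embed True (K - insert x A))"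
    using A1 xK K by (auto simp: wt2_pos_iff all_bool_eq good_add_set simp del: Un_insert_right mset_set.insert)
  then show ?thesis
    using A xK by (auto simp: split_wt_pos_iff[OF K] intro!: exI[of _ "insert x A"])
qed

lemma split_wt_connected:
  assumes K: "finite K" and r: "\<And>i j k. i \<in> UNIV \<times> coords \<Longrightarrow> j \<in> UNIV \<times> coords \<Longrightarrow> k \<in> UNIV \<times> coords \<Longrightarrow>
      split_wt K (add_mset i (add_mset j (add_mset k m))) > 0 \<Longrightarrow> r i = (r j :: real)"
  shows "\<exists>c. \<forall>i\<in>UNIV \<times> coords. \<forall>j\<in>UNIV \<times> coords. \<forall>k\<in>UNIV \<times> coords.
      split_wt K (add_mset i (add_mset j (add_mset k m))) > 0 \<longrightarrow> r i = c"
proof -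
  define T where "T i j k = split_wt K (add_mset i (add_mset j (add_mset k m)))" for i j k
  have T_perm: "T i j k = T j i k" "T i j k = T i k j" for i j k
    by (simp_all add: T_def add_mset_commute)
  have hub: "0 < T (fst i, None) j k" if "0 < T i j k" for i j k
    using split_wt_hub[OF K, of "fst i" "snd i"] that by (simp add: T_def)
  have r': "r i = r j" if "i \<in> UNIV \<times> coords" "j \<in> UNIV \<times> coords" "k \<in> UNIV \<times> coords" "0 < T i j k" for i j k
    using r that by (simp add: T_def)
  \<comment> \<open>Each entry of a positive triple can be replaced by \<open>None\<close> with the
    same flag, so i is adjacent to the hub of j and the three hubs again form a positive
    triple.\<close>
  have hubs: "0 < T (fst j, None) (fst i, None) (fst k, None) \<and> r i = r (fst j, None)"
    if ijk: "i \<in> UNIV \<times> coords" "j \<in> UNIV \<times> coords" "k \<in> UNIV \<times> coords" "0 < T i j k" for i j k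
  proof -
    have 1: "0 < T (fst j, None) i k" using hub[of j i k] ijk T_perm(1) by metis
    then have "0 < T i (fst j, None) k" using T_perm(1) by metis
    then have "r i = r (fst j, None)" using ijk by (intro r'[of _ _ k]) auto
    moreover have "0 < T (fst j, None) (fst i, None) (fst k, None)"
    proof -
      have "0 < T (fst i, None) (fst j, None) k" using hub[of i "(fst j, None)" k] 1 T_perm(1) by metis
      then have "0 < T k (fst i, None) (fst j, None)" using T_perm by metis
      from hub[OF this] show ?thesis using T_perm by metis
    qed
    ultimately show ?thesis by simp
  qed
  define act where "act b \<longleftrightarrow> (\<exists>b1 b2. 0 < T (b, None) (b1, None) (b2, None))" for b
  have eq: "r (False, None) = r (True, None)" if acts: "act False" "act True"
  proof -
    \<comment> \<open>Without a triple mixing the flags, both hubs can be active only through the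
      pure triples, and exchange produces a mixed one from these.\<close>
    have "\<exists>b. 0 < T (False, None) (True, None) (b, None)"
    proof (rule ccontr)
      assume no: "\<not> ?thesis"
      then have no': "\<not> 0 < T (False, None) (True, None) (b, None)" "\<not> 0 < T (False, None) (b, None) (True, None)"
        "\<not> 0 < T (True, None) (False, None) (b, None)" "\<not> 0 < T (True, None) (b, None) (False, None)" for b
        using T_perm by metis+
      have "0 < T (False, None) (False, None) (False, None)"
        using acts(1) no' unfolding act_def by (metis (full_types))
      moreover have "0 < T (True, None) (True, None) (True, None)"
        using acts(2) no' unfolding act_def by (metis (full_types))
      ultimately show False
        using split_wt_exchange[OF K, of m] no by (auto simp: T_def)
    qed
    then show ?thesis using r'[of "(False, None)" "(True, None)"] by auto
  qed
  \<comment> \<open>The flag \<open>\<not> act False\<close> is \<open>False\<close> if the x hub is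
    active and \<open>True\<close> otherwise, so it selects an active hub if there is one.\<close>
  have "r i = r (\<not> act False, None)"
    if "i \<in> UNIV \<times> coords" "j \<in> UNIV \<times> coords" "k \<in> UNIV \<times> coords" "0 < T i j k" for i j k
  proof -
    have "act (fst j)" "r i = r (fst j, None)" using hubs[OF that] by (auto simp: act_def)
    then show ?thesis using eq by (cases "fst j"; cases "act False") auto
  qed
  then have main: "r i = r (\<not> act False, None)"
    if "i \<in> UNIV \<times> coords" "j \<in> UNIV \<times> coords" "k \<in> UNIV \<times> coords"
      "0 < split_wt K (add_mset i (add_mset j (add_mset k m)))" for i j k
    using that unfolding T_def .
  show ?thesis by (intro exI ballI impI) (rule main)
qed

text \<open>Induction on the operators: the induction hypothesis, with one more coordinate added to
  \<open>m\<close>, makes all slices of the third derivative hyperbolic, and contracting along u_x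
  and v_x applies the operator of the new element x.\<close>

lemma hyperbolic_split_wt:
  assumes "finite K" "K \<subseteq> Y" "size m + card K + 2 = 2 * card Y"
  shows "hyperbolic (UNIV \<times> coords) (\<lambda>i j. split_wt K (add_mset i (add_mset j m)))"
  using assms
proof (induction K arbitrary: m)
  case empty
  then show ?case
    using hyperbolic_wt2[of m] by (simp add: split_wt_def embed_def)
next
  case (insert x K)
  let ?E = "UNIV \<times> coords :: (bool \<times> 'a option) set"
  define T where "T i j k = split_wt K (add_mset i (add_mset j (add_mset k m)))" for i j k
  define a :: "bool \<times> 'a option \<Rightarrow> real" where "a e = of_bool (snd e = Some x)" for e
  have fin: "finite coords" using finite_ground by simp
  have "hyperbolic ?E (\<lambda>j k. \<Sum>i\<in>?E. a i * T i j k)"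
  proof (rule hyperbolic_direction)
    show "finite ?E" using fin by simp
    show "T i j k = T j i k" "T i j k = T i k j" for i j k
      by (simp_all add: T_def add_mset_commute)
    show "0 \<le> T i j k" for i j k by (simp add: T_def)
    show "hyperbolic ?E (T i)" for i
    proof -
      have "hyperbolic ?E (\<lambda>j k. split_wt K (add_mset j (add_mset k (add_mset i m))))"
        using insert by (intro insert.IH) auto
      moreover have "T i = (\<lambda>j k. split_wt K (add_mset j (add_mset k (add_mset i m))))"
        by (intro ext) (simp add: T_def add_mset_commute)
      ultimately show ?thesis by simp
    qed
    show "0 \<le> a i" for i by (simp add: a_def)
    fix r :: "bool \<times> 'a option \<Rightarrow> real"
    assume "\<And>i j k. i \<in> ?E \<Longrightarrow> j \<in> ?E \<Longrightarrow> k \<in> ?E \<Longrightarrow> T i j k > 0 \<Longrightarrow> r i = r j"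
    then show "\<exists>c. \<forall>i\<in>?E. \<forall>j\<in>?E. \<forall>k\<in>?E. T i j k > 0 \<longrightarrow> r i = c"
      unfolding T_def by (rule split_wt_connected[OF \<open>finite K\<close>])
  qed
  moreover have "(\<Sum>i\<in>?E. a i * T i j k) = split_wt (insert x K) (add_mset j (add_mset k m))" for j k
  proof -
    have "(\<Sum>u\<in>coords. a (b, u) * T (b, u) j k) = T (b, Some x) j k" for b
    proof -
      have "(\<Sum>u\<in>coords. a (b, u) * T (b, u) j k) = (\<Sum>u\<in>coords. if u = Some x then T (b, u) j k else 0)"
        by (intro sum.cong refl) (simp add: a_def)
      also have "\<dots> = T (b, Some x) j k"
        using insert.prems fin by (subst sum.delta) auto
      finally show ?thesis .
    qed
    then show ?thesis
      unfolding sum_bool_Times[of _ _ False] using insert.hyps by (simp add: split_wt_insert T_def)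
  qed
  ultimately show ?case by simp
qed

section \<open>Splitting a matroid into two independent sets\<close>

definition splits :: "nat \<Rightarrow> 'a set set" where
  "splits i = {A. A \<subseteq> Y \<and> card A = i \<and> indep A \<and> indep (Y - A)}"

lemma finite_splits [simp]: "finite (splits i)"
  by (rule finite_subset[of _ "Pow Y"]) (auto simp: splits_def finite_ground)

text \<open>A choice of u_j for j in A and v_j for the rest survives iff both sets are independent,
  and the degree in x and u forces |A| = n - c = d. The remaining powers of x and y give c!
  d!.\<close>

lemma split_wt_eq_card_splits:
  assumes "c + d = card Y"
  shows "split_wt Y (replicate_mset c (False, None) + replicate_mset d (True, None))
    = fact c * fact d * real (card (splits d))"
proof -
  have "split_wt Y (replicate_mset c (False, None) + replicate_mset d (True, None))
      = (\<Sum>A\<in>Pow Y. if A \<in> splits d then fact c * fact d else 0)"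
    unfolding split_wt_def
  proof (intro sum.cong refl)
    fix A assume "A \<in> Pow Y"
    then have A: "A \<subseteq> Y" "finite A" "finite (Y - A)"
      using finite_ground by (auto intro: finite_subset)
    then have cardA: "card (Y - A) = card Y - card A" "card A \<le> card Y"
      using finite_ground by (auto intro: card_mono simp: card_Diff_subset)
    have rep: "support (replicate_mset k None) = {}" "count (replicate_mset k None) None = k" for k
      by (auto simp: support_def)
    have none: "count (image_mset Some (mset_set B)) None = 0" for B
      by (simp add: count_eq_zero_iff)
    show "wt2 (replicate_mset c (False, None) + replicate_mset d (True, None) + embed False A + embed True (Y - A))
        = (if A \<in> splits d then fact c * fact d else 0)"
      using A cardA assms by (auto simp: wt2_def wt_def good_add_set rep none splits_def)
  qed
  also have "\<dots> = fact c * fact d * real (card (splits d))"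
  proof -
    have "Pow Y \<inter> {A. A \<in> splits d} = splits d" by (auto simp: splits_def)
    then show ?thesis using finite_ground by (simp add: sum.If_cases)
  qed
  finally show ?thesis .
qed

text \<open>Reverse Cauchy-Schwarz between the x and y directions, for the Hessian left by all the
  operators and by c further derivatives in x and d in y.\<close>

lemma splits_log_concave:
  assumes cd: "c + d + 2 = card Y"
  shows "(fact d * fact (c + 2) * real (card (splits d))) * (fact (d + 2) * fact c * real (card (splits (d + 2))))
    \<le> (fact (d + 1) * fact (c + 1) * real (card (splits (d + 1))))\<^sup>2"
proof -
  let ?E = "UNIV \<times> coords :: (bool \<times> 'a option) set"
  define m :: "(bool \<times> 'a option) multiset" where
    "m = replicate_mset c (False, None) + replicate_mset d (True, None)"
  define Q where "Q i j = split_wt Y (add_mset i (add_mset j m))" for i j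
  have fin: "finite ?E" using finite_ground by simp
  have "hyperbolic ?E Q"
    unfolding Q_def using assms finite_ground
    by (intro hyperbolic_split_wt) (auto simp: m_def)
  from hyperbolicD[OF this, of "\<lambda>e. of_bool (e = (True, None))" "\<lambda>e. of_bool (e = (False, None))"]
  have ineq: "Q (False, None) (False, None) * Q (True, None) (True, None) \<le> (Q (False, None) (True, None))\<^sup>2"
    using fin by (simp add: qform_of_bool)
  have "Q (False, None) (False, None) = fact (c + 2) * fact d * real (card (splits d))"
    using split_wt_eq_card_splits[of "c + 2" d] cd by (simp add: Q_def m_def)
  moreover have "Q (False, None) (True, None) = fact (c + 1) * fact (d + 1) * real (card (splits (d + 1)))"
    using split_wt_eq_card_splits[of "c + 1" "d + 1"] cd by (simp add: Q_def m_def add_mset_commute)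
  moreover have "Q (True, None) (True, None) = fact c * fact (d + 2) * real (card (splits (d + 2)))"
    using split_wt_eq_card_splits[of c "d + 2"] cd by (simp add: Q_def m_def)
  ultimately show ?thesis using ineq by (simp add: mult_ac)
qed

lemma card_splits_complement:
  assumes "i \<le> card Y"
  shows "card (splits (card Y - i)) = card (splits i)"
proof (rule bij_betw_same_card)
  show "bij_betw (\<lambda>A. Y - A) (splits (card Y - i)) (splits i)"
    by (rule bij_betwI[where g = "\<lambda>A. Y - A"])
      (use assms finite_ground in \<open>auto simp: splits_def double_diff card_Diff_subset finite_subset\<close>)
qed

text \<open>Exchange enlarges A by one element, while its complement shrinks and so stays
  independent. Hence the counts have no internal zeros.\<close>

lemma splits_Suc_nonempty:
  assumes "splits i \<noteq> {}" "splits j \<noteq> {}" "i < j"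
  shows "splits (Suc i) \<noteq> {}"
proof -
  obtain A B where A: "A \<subseteq> Y" "card A = i" "indep A" "indep (Y - A)" and B: "card B = j" "indep B"
    using assms by (auto simp: splits_def)
  then obtain x where "x \<in> B - A" "indep (insert x A)" using indep_exchange[of A B] assms by auto
  moreover have "indep (Y - insert x A)" by (rule indep_subset[OF A(4)]) auto
  ultimately have "insert x A \<in> splits (Suc i)"
    using A B indep_ground finite_indep by (auto simp: splits_def)
  then show ?thesis by blast
qed

lemma splits_between_nonempty:
  assumes "splits i \<noteq> {}" "splits j \<noteq> {}" "i \<le> k" "k \<le> j"
  shows "splits k \<noteq> {}"
  using assms(3,4)
proof (induction rule: dec_induct)
  case base
  then show ?case using assms by simp
next
  case (step k)
  then show ?case using splits_Suc_nonempty[of k j] assms by auto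
qed

text \<open>The sequence \<open>g\<close> is log-concave, symmetric about n/2 and positive between n
  - a and a if g(a) > 0. A strict increase at its last step would force strict increase all the way
  from n - a to a, contradicting g(n - a) = g(a). The claim is g(a) <= g(a - 1) after cancelling (a
  - 1)! (n - a)!.\<close>

lemma card_splits_pred:
  assumes a: "a \<le> card Y" "card Y < 2 * a"
  shows "a * card (splits a) \<le> (card Y - a + 1) * card (splits (a - 1))"
proof -
  define n where "n = card Y"
  define g where "g i = fact i * fact (n - i) * real (card (splits i))" for i
  have g_nonneg: "g i \<ge> 0" for i by (simp add: g_def)
  have log_concave: "g k * g (k + 2) \<le> (g (k + 1))\<^sup>2" if "k + 2 \<le> n" for k
  proof -
    define c where "c = n - (k + 2)"
    have c: "n = c + k + 2" using that by (simp add: c_def)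
    then have "n - k = c + 2" "n - (k + 1) = c + 1" "n - (k + 2) = c" by auto
    then show ?thesis
      using splits_log_concave[of c k] c by (simp only: g_def n_def)
  qed
  have "g a \<le> g (a - 1)"
  proof (rule ccontr)
    assume "\<not> ?thesis"
    then have lt: "g (a - 1) < g a" by simp
    then have "g a \<noteq> 0" using g_nonneg[of "a - 1"] by linarith
    then have "splits a \<noteq> {}" by (auto simp: g_def)
    moreover have sym: "card (splits (n - a)) = card (splits a)"
      using card_splits_complement a by (simp add: n_def)
    ultimately have "splits (n - a) \<noteq> {}" using finite_splits by (metis card_eq_0_iff)
    then have pos: "g k > 0" if "n - a \<le> k" "k \<le> a" for k
      using splits_between_nonempty[OF _ \<open>splits a \<noteq> {}\<close> that] by (simp add: g_def card_gt_0_iff)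
    \<comment> \<open>Downward propagation: by log-concavity and positivity, an increase from k + 1
      to k + 2 forces one from k to k + 1.\<close>
    have less_Suc: "g k < g (Suc k)" if "n - a \<le> k" "k \<le> a - 1" for k
      using that(2,1)
    proof (induction rule: inc_induct)
      case base
      then show ?case using lt a by simp
    next
      case (step k)
      then have lt: "g (k + 1) < g (k + 2)" and "g (k + 1) > 0" using pos by auto
      have "g k * g (k + 2) \<le> g (k + 1) * g (k + 1)"
        using log_concave[of k] step a by (simp add: n_def power2_eq_square)
      also have "\<dots> < g (k + 1) * g (k + 2)"
        using lt \<open>g (k + 1) > 0\<close> by (rule mult_strict_left_mono)
      finally show ?case using lt \<open>g (k + 1) > 0\<close> by simp
    qed
    have "n - a < a" using a by (simp add: n_def)
    moreover have "g (n - a) < g j" if "n - a < j" "j \<le> a" for j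
      using that
    proof (induction j)
      case (Suc j)
      then have "g j < g (Suc j)" by (intro less_Suc) auto
      then show ?case using Suc by (cases "n - a = j") auto
    qed simp
    ultimately have "g (n - a) < g a" by simp
    moreover have "n - (n - a) = a" using a by (simp add: n_def)
    ultimately show False using sym by (simp add: g_def mult.commute)
  qed
  moreover have "n - (a - 1) = Suc (n - a)" using a by (simp add: n_def)
  moreover obtain a' where "a = Suc a'" using a by (cases a) auto
  ultimately have "fact a' * fact (n - a) * (real a * card (splits a))
      \<le> fact a' * fact (n - a) * ((real (n - a) + 1) * card (splits (a - 1)))"
    by (simp add: g_def algebra_simps)
  then have "real a * card (splits a) \<le> (real (n - a) + 1) * card (splits (a - 1))"
    by simp
  also have "real (n - a) + 1 = real (n - a + 1)" by simp
  finally show ?thesis unfolding n_def by (simp only: of_nat_mult[symmetric] of_nat_le_iff)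
qed

lemma matroid_restrict:
  assumes "Z \<subseteq> Y"
  shows "matroid Z (\<lambda>A. indep A \<and> A \<subseteq> Z)"
proof
  show "finite Z" using assms finite_ground finite_subset by blast
  fix A B assume "indep A \<and> A \<subseteq> Z" "indep B \<and> B \<subseteq> Z" "card A < card B"
  then show "\<exists>x\<in>B - A. indep (insert x A) \<and> insert x A \<subseteq> Z"
    using indep_exchange[of A B] by blast
qed (use indep_empty indep_subset in auto)

text \<open>Meant for the union Z of two blocks, between which an element moves while the other
  blocks stay fixed.\<close>

lemma card_splits_pred_restrict:
  assumes "Z \<subseteq> Y" "card Z = a + b" "b < a"
  shows "a * card {A. A \<subseteq> Z \<and> card A = a \<and> indep A \<and> indep (Z - A)}
    \<le> (b + 1) * card {A. A \<subseteq> Z \<and> card A = a - 1 \<and> indep A \<and> indep (Z - A)}"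
proof -
  interpret Z: matroid Z "\<lambda>A. indep A \<and> A \<subseteq> Z" by (rule matroid_restrict[OF assms(1)])
  have "Z.splits i = {A. A \<subseteq> Z \<and> card A = i \<and> indep A \<and> indep (Z - A)}" for i
    by (auto simp: Z.splits_def)
  then show ?thesis using Z.card_splits_pred[of a] assms by simp
qed

end

section \<open>Moving elements between blocks\<close>

lemma UN_lessThan_split:
  assumes "s < (l::nat)" "t < l"
  shows "(\<Union>i<l. f i) = f s \<union> f t \<union> (\<Union>i\<in>{..<l} - {s, t}. f i)"
  using assms by auto

lemma indep_partitions_update:
  assumes As: "As \<in> indep_partitions Y indep is"
    and st: "s < length is" "t < length is" "s \<noteq> t"
    and js: "js = is[s := x, t := y]"
    and A: "A \<subseteq> As ! s \<union> As ! t" "indep A" "int (card A) = x"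
      "indep (As ! s \<union> As ! t - A)" "int (card (As ! s \<union> As ! t - A)) = y"
  shows "As[s := A, t := As ! s \<union> As ! t - A] \<in> indep_partitions Y indep js"
proof -
  define Bs where "Bs = As[s := A, t := As ! s \<union> As ! t - A]"
  have len: "length As = length is" and dis: "disjoint_family_on (\<lambda>i. As ! i) {..<length is}"
    and un: "(\<Union>i<length is. As ! i) = Y"
    and ind: "\<And>i. i < length is \<Longrightarrow> indep (As ! i) \<and> int (card (As ! i)) = is ! i"
    using As by (auto simp: indep_partitions_def)
  have Bs: "Bs ! s = A" "Bs ! t = As ! s \<union> As ! t - A"
    "\<And>i. i \<noteq> s \<Longrightarrow> i \<noteq> t \<Longrightarrow> Bs ! i = As ! i"
    using st len by (auto simp: Bs_def)
  have dis': "As ! i \<inter> As ! j = {}" if "i < length is" "j < length is" "i \<noteq> j" for i j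
    using dis that by (auto simp: disjoint_family_on_def)
  have "disjoint_family_on (\<lambda>i. Bs ! i) {..<length is}"
    unfolding disjoint_family_on_def
  proof (intro ballI impI)
    fix i j assume ij: "i \<in> {..<length is}" "j \<in> {..<length is}" "i \<noteq> j"
    have other: "(As ! s \<union> As ! t) \<inter> As ! k = {}" if "k < length is" "k \<noteq> s" "k \<noteq> t" for k
      using dis'[of s k] dis'[of t k] that st by auto
    show "Bs ! i \<inter> Bs ! j = {}"
      using ij dis'[of i j] other[of i] other[of j] A(1) st
      by (cases "i = s"; cases "i = t"; cases "j = s"; cases "j = t") (auto simp: Bs)
  qed
  moreover have "(\<Union>i<length is. Bs ! i) = Y"
    using un A(1) unfolding UN_lessThan_split[OF st(1,2)] by (auto simp: Bs)
  moreover have "indep (Bs ! i) \<and> int (card (Bs ! i)) = js ! i" if "i < length is" for i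
    using ind[OF that] A st that by (cases "i = s"; cases "i = t") (auto simp: Bs js)
  ultimately show ?thesis
    using len by (simp add: indep_partitions_def js flip: Bs_def) (simp add: Bs_def)
qed

lemma card_le_sum_fibres:
  fixes key :: "'a \<Rightarrow> 'b"
  assumes "finite S" "finite S'" and fib: "\<And>k. a * card {x \<in> S. key x = k} \<le> b * card {x \<in> S'. key x = k}"
  shows "a * card S \<le> b * card S'"
proof -
  let ?K = "key ` S \<union> key ` S'"
  have eq: "card T = (\<Sum>k\<in>?K. card {x \<in> T. key x = k})" if "T = S \<or> T = S'" for T
  proof -
    have "(\<Sum>k\<in>?K. \<Sum>x\<in>{x \<in> T. key x = k}. 1) = (\<Sum>x\<in>T. 1 :: nat)"
      using assms that by (intro sum.group) auto
    then show ?thesis by simp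
  qed
  show ?thesis using eq[of S] eq[of S'] by (simp add: sum_distrib_left fib sum_mono)
qed

context matroid
begin

text \<open>Group the partitions by their blocks other than s and t. A group before the move injects
  into the splits of the union Z of the two blocks with a part of size a, and the splits with a part
  of size a - 1 inject into the group after the move.\<close>

lemma num_indep_partitions_transfer:
  assumes st: "s < length is" "t < length is" "s \<noteq> t"
    and ab: "is ! s = int a" "is ! t = int b" "b < a"
  shows "a * num_indep_partitions Y indep is
    \<le> (b + 1) * num_indep_partitions Y indep (is[s := int a - 1, t := int b + 1])"
  unfolding num_indep_partitions_def
proof (rule card_le_sum_fibres)
  let ?js = "is[s := int a - 1, t := int b + 1]"
  let ?P = "indep_partitions Y indep is" and ?P' = "indep_partitions Y indep ?js"
  \<comment> \<open>Emptying the blocks \<open>s\<close> and \<open>t\<close> records the other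
    blocks.\<close>
  let ?key = "\<lambda>As. As[s := {}, t := {}]"
  show "finite ?P" "finite ?P'" using finite_ground by (auto intro: finite_indep_partitions)
  fix \<kappa>
  show "a * card {As \<in> ?P. ?key As = \<kappa>} \<le> (b + 1) * card {As \<in> ?P'. ?key As = \<kappa>}"
  proof (cases "{As \<in> ?P. ?key As = \<kappa>} = {}")
    case True
    then show ?thesis by (simp only: card.empty mult_0_right zero_le)
  next
    case False
    then obtain Bs where Bs: "Bs \<in> ?P" "?key Bs = \<kappa>" by blast
    define Z where "Z = Bs ! s \<union> Bs ! t"
    define F where "F i = {A. A \<subseteq> Z \<and> card A = i \<and> indep A \<and> indep (Z - A)}" for i
    have len: "length As = length is" if "As \<in> ?P" for As using that by (simp add: indep_partitions_def)
    have dis: "As ! s \<inter> As ! t = {}" and un: "(\<Union>i<length is. As ! i) = Y"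
      and cards: "card (As ! s) = a" "card (As ! t) = b" "indep (As ! s)" "indep (As ! t)" if "As \<in> ?P" for As
      using that st ab by (auto simp: indep_partitions_def disjoint_family_on_def)
    have "Z \<subseteq> Y" using un[OF Bs(1)] st by (auto simp: Z_def)
    then have "finite Z" using finite_ground finite_subset by blast
    have cardZ: "card Z = a + b"
      using cards[OF Bs(1)] dis[OF Bs(1)] \<open>finite Z\<close> by (simp add: Z_def card_Un_disjoint)
    have same: "As ! i = Bs ! i" if "?key As = \<kappa>" "i \<noteq> s" "i \<noteq> t" for As i
    proof -
      have "As ! i = ?key As ! i" using that(2,3) by simp
      also have "\<dots> = ?key Bs ! i" by (simp only: that(1) Bs(2))
      also have "\<dots> = Bs ! i" using that(2,3) by simp
      finally show ?thesis .
    qed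
    \<comment> \<open>Throughout a fibre the union of the two blocks is the same \<open>Z\<close>,
      the part of \<open>Y\<close> outside the fixed blocks, so the block \<open>s\<close>
      determines the partition.\<close>
    have Z: "As ! t = Z - As ! s" "As ! s \<subseteq> Z" if As: "As \<in> ?P" "?key As = \<kappa>" for As
    proof -
      let ?W = "\<Union>i\<in>{..<length is} - {s, t}. Bs ! i"
      have W: "(\<Union>i\<in>{..<length is} - {s, t}. As ! i) = ?W" using same[OF As(2)] by auto
      have W_dis: "(Cs ! s \<union> Cs ! t) \<inter> (\<Union>i\<in>{..<length is} - {s, t}. Cs ! i) = {}" if "Cs \<in> ?P" for Cs
        using that st by (fastforce simp: indep_partitions_def disjoint_family_on_def)
      have "As ! s \<union> As ! t \<union> ?W = Z \<union> ?W"
        using un[OF As(1)] un[OF Bs(1)] unfolding UN_lessThan_split[OF st(1,2)] W Z_def by simp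
      then have "As ! s \<union> As ! t = Z"
        using W_dis[OF As(1)] W_dis[OF Bs(1)] unfolding W Z_def by blast
      then show "As ! t = Z - As ! s" "As ! s \<subseteq> Z" using dis[OF As(1)] by auto
    qed
    have "card {As \<in> ?P. ?key As = \<kappa>} \<le> card (F a)"
    proof (rule card_inj_on_le[where f = "\<lambda>As. As ! s"])
      show "inj_on (\<lambda>As. As ! s) {As \<in> ?P. ?key As = \<kappa>}"
      proof (rule inj_onI)
        fix As Cs
        assume "As \<in> {As \<in> ?P. ?key As = \<kappa>}" "Cs \<in> {As \<in> ?P. ?key As = \<kappa>}"
          and eq: "As ! s = Cs ! s"
        then have As: "As \<in> ?P" "?key As = \<kappa>" and Cs: "Cs \<in> ?P" "?key Cs = \<kappa>"
          by blast+
        show "As = Cs"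
        proof (rule nth_equalityI)
          show "length As = length Cs" using len As Cs by simp
          fix i
          show "As ! i = Cs ! i"
            using same[OF As(2), of i] same[OF Cs(2), of i] Z(1)[OF As] Z(1)[OF Cs] eq
            by (cases "i = s"; cases "i = t") auto
        qed
      qed
      show "(\<lambda>As. As ! s) ` {As \<in> ?P. ?key As = \<kappa>} \<subseteq> F a"
        using Z cards by (force simp: F_def)
      show "finite (F a)" using \<open>finite Z\<close> by (auto simp: F_def intro: finite_subset[of _ "Pow Z"])
    qed
    then have "a * card {As \<in> ?P. ?key As = \<kappa>} \<le> a * card (F a)" by simp
    also have "\<dots> \<le> (b + 1) * card (F (a - 1))"
      unfolding F_def by (rule card_splits_pred_restrict[OF \<open>Z \<subseteq> Y\<close> cardZ ab(3)])
    also have "\<dots> \<le> (b + 1) * card {As \<in> ?P'. ?key As = \<kappa>}"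
    proof (rule mult_le_mono2, rule card_inj_on_le[where f = "\<lambda>A. Bs[s := A, t := Z - A]"])
      show "inj_on (\<lambda>A. Bs[s := A, t := Z - A]) (F (a - 1))"
      proof (rule inj_onI)
        fix A B assume "Bs[s := A, t := Z - A] = Bs[s := B, t := Z - B]"
        then have "Bs[s := A, t := Z - A] ! s = Bs[s := B, t := Z - B] ! s" by simp
        then show "A = B" using st len[OF Bs(1)] by simp
      qed
      show "(\<lambda>A. Bs[s := A, t := Z - A]) ` F (a - 1) \<subseteq> {As \<in> ?P'. ?key As = \<kappa>}"
      proof (rule image_subsetI)
        fix A assume A: "A \<in> F (a - 1)"
        have "card (Z - A) = card Z - card A"
          using A \<open>finite Z\<close> by (auto simp: F_def card_Diff_subset finite_subset)
        then have "Bs[s := A, t := Z - A] \<in> ?P'"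
          using A ab cardZ unfolding Z_def
          by (intro indep_partitions_update[OF Bs(1) st refl]) (auto simp: F_def Z_def)
        moreover have "?key (Bs[s := A, t := Z - A]) = \<kappa>"
          using Bs(2) st by (simp add: list_update_swap)
        ultimately show "Bs[s := A, t := Z - A] \<in> {As \<in> ?P'. ?key As = \<kappa>}" by blast
      qed
      show "finite {As \<in> ?P'. ?key As = \<kappa>}" using \<open>finite ?P'\<close> by simp
    qed
    finally show ?thesis .
  qed
qed

end

section \<open>The chain of p - 1 moves between the two tuples\<close>

theorem theorem4p3:
  fixes Y :: "'a set" and indep :: "'a set \<Rightarrow> bool" and p k :: nat
  assumes "p > 0" and "k > 0"
    and "matroid Y indep"
    and "card Y = p * k"
  shows "real (num_indep_partitions Y indep (replicate p (int k)))
    \<ge> (\<Prod>j=1..p - 1. 1 + real j / (real (p - 1) * real k))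
      * real (num_indep_partitions Y indep
          (replicate (p - 1) (int k + 1) @ [int k - (int p - 1)]))"
proof -
  interpret matroid Y indep by fact
  define q where "q = p - 1"
  have p: "p = Suc q" using assms(1) by (simp add: q_def)
  \<comment> \<open>The sizes after i moves: the first i blocks have come down from k + 1 to k, and
    the last block has gained i elements. So \<open>tup 0\<close> and \<open>tup q\<close> are the
    two tuples to be compared.\<close>
  define tup where "tup i = map (\<lambda>j. if j < i then int k else if j < q then int k + 1
    else int k - int q + int i) [0..<p]" for i
  define N where "N i = real (num_indep_partitions Y indep (tup i))" for i
  have step: "(1 + 1 / real k) * N i \<le> N (Suc i)" if i: "i < q" for i
  proof (cases "int k - int q + int i < 0")
    case True
    \<comment> \<open>A negative last entry makes the count 0.\<close>
    then have "tup i ! q < 0" "q < length (tup i)" using i by (simp_all add: tup_def p del: upt_Suc)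
    then have "indep_partitions Y indep (tup i) = {}"
      by (force simp: indep_partitions_def)
    then show ?thesis by (simp add: N_def num_indep_partitions_def)
  next
    case False
    define b where "b = nat (int k - int q + int i)"
    have b: "int b = int k - int q + int i" using False by (simp add: b_def)
    have "tup (Suc i) = (tup i)[i := int (k + 1) - 1, q := int b + 1]"
      by (rule nth_equalityI) (use i b in \<open>auto simp: tup_def p nth_list_update simp del: upt_Suc\<close>)
    moreover have "(k + 1) * num_indep_partitions Y indep (tup i)
        \<le> (b + 1) * num_indep_partitions Y indep ((tup i)[i := int (k + 1) - 1, q := int b + 1])"
      by (rule num_indep_partitions_transfer) (use i b in \<open>auto simp: tup_def p simp del: upt_Suc\<close>)
    ultimately have "(k + 1) * num_indep_partitions Y indep (tup i)
        \<le> (b + 1) * num_indep_partitions Y indep (tup (Suc i))" by simp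
    \<comment> \<open>Since i < q, b + 1 = k - q + i + 1 is at most k.\<close>
    also have "\<dots> \<le> k * num_indep_partitions Y indep (tup (Suc i))"
      using i b by (intro mult_right_mono) auto
    finally have "real (k + 1) * N i \<le> real k * N (Suc i)"
      unfolding N_def by (simp only: of_nat_mult[symmetric] of_nat_le_iff)
    then show ?thesis using assms(2) by (simp add: field_simps)
  qed
  have "(1 + 1 / real k) ^ i * N 0 \<le> N i" if "i \<le> q" for i
    using that
  proof (induction i)
    case (Suc i)
    then have "(1 + 1 / real k) * ((1 + 1 / real k) ^ i * N 0) \<le> (1 + 1 / real k) * N i"
      by (intro mult_left_mono) auto
    also have "\<dots> \<le> N (Suc i)" using Suc.prems by (intro step) simp
    finally show ?case by (simp add: mult_ac)
  qed simp
  then have pow: "(1 + 1 / real k) ^ q * N 0 \<le> N q" by simp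
  \<comment> \<open>Factor by factor, as j / (q k) <= 1 / k for j <= q; for q = 0 both products are
    empty.\<close>
  have "(\<Prod>j=1..q. 1 + real j / (real q * real k)) \<le> (\<Prod>j=1..q. 1 + 1 / real k)"
  proof (intro prod_mono conjI)
    fix j assume "j \<in> {1..q}"
    then show "1 + real j / (real q * real k) \<le> 1 + 1 / real k"
      using assms(2) by (simp add: field_simps)
  qed simp
  then have "(\<Prod>j=1..q. 1 + real j / (real q * real k)) * N 0 \<le> (1 + 1 / real k) ^ q * N 0"
    by (intro mult_right_mono) (simp_all add: N_def)
  also note pow
  also have "tup q = replicate p (int k)"
    by (rule nth_equalityI) (auto simp: tup_def p simp del: upt_Suc replicate_Suc)
  then have "N q = real (num_indep_partitions Y indep (replicate p (int k)))" by (simp add: N_def)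
  also have "tup 0 = replicate (p - 1) (int k + 1) @ [int k - (int p - 1)]"
    by (rule nth_equalityI) (auto simp: tup_def p nth_append simp del: upt_Suc)
  then have "N 0 = real (num_indep_partitions Y indep (replicate (p - 1) (int k + 1) @ [int k - (int p - 1)]))"
    by (simp add: N_def)
  finally show ?thesis by (simp add: q_def)
qed

end
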